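(* Let $(W,W')$ be an exchangeable pair of integer-valued random variables with $\mathbb{E}W=\mu$ and $0<\operatorname{Var}W=\sigma^2<\infty$. Assume that there are a number $0<\lambda<1$ and a random variable $R$ such that $$\mathbb{E}^W(W'-\mu)=(1-\lambda)(W-\mu)+R ,$$ and that $W'-W\in\{-1,0,+1\}$. Let $S=S(W)=\mathbb{P}[W'=W+1\mid W]$ and $q_{\max}=\max_{k\in\mathbb{Z}}\mathbb{P}[W=k]$. Assume in addition that $S$, as a function of the value of $W$, can be extended to $\mathbb{R}$ such that it is Lipschitz continuous, with Lipschitz constant $L_S$. Put $$d=\frac{2\sqrt{q_{\max}\operatorname{Var}S}}{\lambda\sigma^2}+\frac{2q_{\max}\sqrt{\operatorname{Var}R}}{\lambda\sigma}+\frac{\sqrt{\operatorname{Var}R}}{\lambda\sigma^2}+\frac{2}{\sigma^2}.$$ Then $$d_{\mathrm{loc}}(\mathscr{L}(W),\mathrm{TP}(\mu,\sigma^2))\le \frac{2L_S\bigl(\sigma^{-3}\mathbb{E}|W-\mu|^3\vee(d\sigma^{3/2}+1)\bigr)}{\lambda\sigma^2}+\frac{2L_Sq_{\max}}{\lambda\sigma}+\frac{2q_{\max}\sqrt{\operatorname{Var}R}}{\lambda\sigma}+\frac{\sqrt{\operatorname{Var}R}}{\lambda\sigma^2}+\frac{2}{\sigma^2}.$$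
   Context: $\mathscr{L}(X)$ denotes the law of $X$. A pair $(W,W')$ is exchangeable if $\mathscr{L}(W,W')=\mathscr{L}(W',W)$. $\mathbb{E}^W$ denotes conditional expectation given $W$; $a\vee b=\max(a,b)$. Translated Poisson distribution: for $\mu\in\mathbb{R}$, $\sigma^2>0$, an integer-valued random variable $Y$ has law $\mathrm{TP}(\mu,\sigma^2)$ if $\mathscr{L}(Y-\mu+\sigma^2+\gamma)=\mathrm{Po}(\sigma^2+\gamma)$, where $\gamma=\langle\mu-\sigma^2\rangle$, $\langle x\rangle=x-\lfloor x\rfloor$ is the fractional part, and $\mathrm{Po}(\nu)$ is the Poisson distribution with mean $\nu$. For probability distributions $P,Q$ on $\mathbb{Z}$ with point probabilities $p_k,q_k$: $d_{\mathrm{loc}}(P,Q)=\sup_{k\in\mathbb{Z}}|p_k-q_k|$. *)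

theory Defs
  imports "HOL-Probability.Probability"
begin

definition exchangeable_pair :: "'a measure \<Rightarrow> ('a \<Rightarrow> int) \<Rightarrow> ('a \<Rightarrow> int) \<Rightarrow> bool" where
  "exchangeable_pair M X Y \<longleftrightarrow>
     distr M (count_space UNIV \<Otimes>\<^sub>M count_space UNIV) (\<lambda>\<omega>. (X \<omega>, Y \<omega>)) =
     distr M (count_space UNIV \<Otimes>\<^sub>M count_space UNIV) (\<lambda>\<omega>. (Y \<omega>, X \<omega>))"

text \<open>Conditional expectation given the sigma-algebra generated by an integer-valued \<open>X\<close>;
  like \<^const>\<open>real_cond_exp\<close> it is one version, meaningful up to null sets.\<close>

definition cond_exp_given :: "'a measure \<Rightarrow> ('a \<Rightarrow> int) \<Rightarrow> ('a \<Rightarrow> real) \<Rightarrow> 'a \<Rightarrow> real" where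
  "cond_exp_given M X f = real_cond_exp M (vimage_algebra (space M) X (count_space UNIV)) f"

definition cond_prob_given :: "'a measure \<Rightarrow> ('a \<Rightarrow> int) \<Rightarrow> ('a \<Rightarrow> bool) \<Rightarrow> 'a \<Rightarrow> real" where
  "cond_prob_given M X P = cond_exp_given M X (indicator {\<omega> \<in> space M. P \<omega>})"

text \<open>The translated Poisson law \<open>TP(\<mu>, v)\<close> for \<open>v > 0\<close>.  The defining condition is that
  \<open>Y - \<mu> + v + \<gamma>\<close>, with \<open>\<gamma> = frac (\<mu> - v)\<close>, has the Poisson law with mean \<open>v + \<gamma>\<close>; since
  \<open>\<mu> - v - \<gamma>\<close> is the integer \<open>\<lfloor>\<mu> - v\<rfloor>\<close>, this determines the law of \<open>Y\<close>, as made precise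
  by the lemma following the definition.\<close>

definition translated_poisson :: "real \<Rightarrow> real \<Rightarrow> int pmf" where
  "translated_poisson \<mu> v =
     map_pmf (\<lambda>n. int n + \<lfloor>\<mu> - v\<rfloor>) (poisson_pmf (v + frac (\<mu> - v)))"

lemma translated_poisson_iff:
  "P = translated_poisson \<mu> v \<longleftrightarrow>
     map_pmf (\<lambda>y. real_of_int y - \<mu> + v + frac (\<mu> - v)) P =
     map_pmf real (poisson_pmf (v + frac (\<mu> - v)))"
proof -
  let ?f = "\<lambda>y. real_of_int y - \<mu> + v + frac (\<mu> - v)"
  have "inj ?f" by (auto simp: inj_def)
  moreover have "map_pmf ?f (translated_poisson \<mu> v) =
      map_pmf real (poisson_pmf (v + frac (\<mu> - v)))"
    unfolding translated_poisson_def pmf.map_comp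
    by (intro pmf.map_cong refl) (simp add: frac_def)
  ultimately show ?thesis
    by (metis pmf.inj_map injD)
qed

definition d_loc :: "int measure \<Rightarrow> int measure \<Rightarrow> real" where
  "d_loc P Q = (SUP k. \<bar>measure P {k} - measure Q {k}\<bar>)"

end

theory Submission
  imports Defs
begin

text \<open>The proof is Stein's method for the Poisson distribution, carried out at single points.

  Let \<open>m = \<lfloor>\<mu> - \<sigma>\<^sup>2\<rfloor>\<close> and \<open>\<nu> = \<mu> - m\<close>, so that \<open>TP(\<mu>, \<sigma>\<^sup>2)\<close> is \<open>Po(\<nu>)\<close> moved by \<open>m\<close>.  The Stein equation
  \<open>\<nu> g(j + 1) - j g(j) = [j = n] - Po(\<nu>){n}\<close> has a solution that decreases from 0 up to \<open>n\<close>, makes one jump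
  upwards of size at most \<open>1 / \<nu>\<close>, and then decreases while staying nonnegative.  Hence \<open>g\<close> and its
  differences \<open>D g\<close> are bounded by \<open>1 / \<nu>\<close>, and the differences have an absolute sum of at most \<open>2 / \<nu>\<close>
  (\<open>abs_poisson_stein\<close>, \<open>abs_poisson_stein_difference\<close>, \<open>sum_abs_poisson_stein_differences\<close>).  The bound
  on the sum is what brings in \<open>q_max\<close>: it gives \<open>E \<psi>(W) \<bar>D g(W)\<bar> \<le> (2 / \<sigma>\<^sup>2) max\<^sub>k \<psi>(k) P[W = k]\<close> for
  nonnegative \<open>\<psi>\<close> (\<open>expectation_weighted_D_le\<close>).

  By exchangeability and the regression condition,
  \<open>lam E[(W - \<mu>) \<phi>(W)] = E[R \<phi>(W)] + E[S D \<phi>(W)]\<close> for all suitable \<open>\<phi>\<close> (\<open>pair_identity\<close>).  With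
  \<open>\<phi>(k) = k - \<mu>\<close> this identifies \<open>E S\<close> as \<open>lam \<sigma>\<^sup>2\<close> up to a remainder involving \<open>R\<close>.  With the Stein
  solution for \<open>\<phi>\<close> it turns \<open>P[W = m + n] - Po(\<nu>){n}\<close> into \<open>- Cov(S, D g(W)) / lam\<close>, up to terms with
  \<open>R\<close>, the term \<open>(\<nu> - \<sigma>\<^sup>2) E D g(W)\<close>, and the mass of \<open>W\<close> to the left of \<open>m\<close>, which Chebyshev's
  inequality controls (\<open>point_error\<close>).

  The covariance is estimated twice.  The Cauchy-Schwarz inequality yields \<open>d\<close> as a first local bound.
  If \<open>S\<close> is a Lipschitz function of \<open>W\<close>, then \<open>\<bar>S - E S\<bar> \<le> L (\<bar>W - \<mu>\<bar> + \<sigma>)\<close>, and the covariance is at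
  most \<open>2 L (max\<^sub>k \<bar>k - \<mu>\<bar> P[W = k] + \<sigma> q_max) / \<sigma>\<^sup>2\<close> (\<open>up_cov_le_lipschitz\<close>).  This maximum is bounded by
  the third moment where \<open>\<bar>k - \<mu>\<bar> \<ge> \<sigma>\<^bsup>3/2\<^esup>\<close>.  For the other \<open>k\<close> the first local bound allows replacing
  \<open>P[W = k]\<close> by the Poisson weight, and \<open>\<bar>j - \<nu>\<bar> Po(\<nu>){j} \<le> 1\<close> because the Poisson weights are unimodal
  (\<open>poisson_deviation_weight_le_1\<close>, \<open>atom_deviation\<close>).\<close>

section \<open>Poisson weights\<close>

lemma poisson_weight_Suc:
  assumes "0 < \<nu>"
  shows "real (Suc n) * pmf (poisson_pmf \<nu>) (Suc n) = \<nu> * pmf (poisson_pmf \<nu>) n"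
proof -
  have "real (Suc n) * (\<nu> ^ Suc n / fact (Suc n)) = \<nu> * (\<nu> ^ n / fact n)"
    unfolding fact_Suc of_nat_mult power_Suc by (simp del: of_nat_Suc)
  then show ?thesis
    using assms by (simp only: pmf_poisson mult.assoc[symmetric])
qed

lemma sum_poisson_weights_le_1: "(\<Sum>i\<in>I. pmf (poisson_pmf \<nu>) i) \<le> 1" if "finite I"
  using measure_measure_pmf_finite[OF that, of "poisson_pmf \<nu>"]
    measure_pmf.prob_le_1[of "poisson_pmf \<nu>" I] by simp

lemma poisson_weights_sums:
  assumes "0 < \<nu>"
  shows "(\<lambda>n. pmf (poisson_pmf \<nu>) n) sums 1"
proof -
  have "(\<lambda>n. \<nu> ^ n / fact n) sums exp \<nu>"
    using exp_converges[of \<nu>] by (simp add: divide_inverse mult.commute)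
  from sums_mult2[OF this, of "exp (- \<nu>)"] show ?thesis
    using assms by (simp add: exp_minus pmf_poisson[OF assms] field_simps)
qed

text \<open>The weights increase up to \<open>\<lfloor>\<nu>\<rfloor>\<close> and decrease from there on.  So the weights
  at the integers from \<open>\<lfloor>\<nu>\<rfloor>\<close> to \<open>j\<close>, of which there are at least \<open>\<bar>j - \<nu>\<bar>\<close>, are no smaller than the one
  at \<open>j\<close>, and they add up to at most 1.\<close>

lemma poisson_deviation_weight_le_1:
  assumes "0 < \<nu>"
  shows "\<bar>real j - \<nu>\<bar> * pmf (poisson_pmf \<nu>) j \<le> 1"
proof -
  let ?p = "pmf (poisson_pmf \<nu>)"
  define m where "m = nat \<lfloor>\<nu>\<rfloor>"
  have m: "real m \<le> \<nu>" "\<nu> < real m + 1"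
    using assms by (auto simp: m_def)
  have up: "?p n \<le> ?p (Suc n)" if "Suc n \<le> m" for n
  proof -
    have "real (Suc n) * ?p n \<le> \<nu> * ?p n"
      using that m by (intro mult_right_mono) auto
    also have "\<dots> = real (Suc n) * ?p (Suc n)"
      using poisson_weight_Suc[OF assms] by simp
    finally show ?thesis by (simp del: pmf_poisson of_nat_Suc)
  qed
  have down: "?p (Suc n) \<le> ?p n" if "m \<le> n" for n
  proof -
    have "real (Suc n) * ?p (Suc n) = \<nu> * ?p n"
      using poisson_weight_Suc[OF assms] by simp
    also have "\<dots> \<le> real (Suc n) * ?p n"
      using that m by (intro mult_right_mono) auto
    finally show ?thesis by (simp del: pmf_poisson of_nat_Suc)
  qed
  show ?thesis
  proof (cases "j \<le> m")
    case True
    have le: "?p j \<le> ?p i" if "i \<in> {j..m}" for i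
    proof -
      from that have "j \<le> i" "i \<le> m" by auto
      then show ?thesis
      proof (induction i rule: dec_induct)
        case (step n)
        then show ?case using up[of n] by linarith
      qed simp
    qed
    have "\<bar>real j - \<nu>\<bar> * ?p j \<le> real (card {j..m}) * ?p j"
      using True m by (intro mult_right_mono) (auto simp del: pmf_poisson)
    also have "\<dots> \<le> (\<Sum>i\<in>{j..m}. ?p i)"
      using sum_mono[OF le, of "{j..m}" "\<lambda>i. i"] by simp
    also have "\<dots> \<le> 1" by (rule sum_poisson_weights_le_1) simp
    finally show ?thesis .
  next
    case False
    have le: "?p j \<le> ?p i" if "i \<in> {m..j}" for i
    proof -
      from that have "i \<le> j" "m \<le> i" by auto
      then show ?thesis
      proof (induction j rule: dec_induct)
        case (step n)
        then show ?case using down[of n] by linarith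
      qed simp
    qed
    have "\<bar>real j - \<nu>\<bar> * ?p j \<le> real (card {m..j}) * ?p j"
      using False m by (intro mult_right_mono) (auto simp del: pmf_poisson)
    also have "\<dots> \<le> (\<Sum>i\<in>{m..j}. ?p i)"
      using sum_mono[OF le, of "{m..j}" "\<lambda>i. i"] by simp
    also have "\<dots> \<le> 1" by (rule sum_poisson_weights_le_1) simp
    finally show ?thesis .
  qed
qed

section \<open>The Stein equation of the Poisson law at a single point\<close>

text \<open>Multiplied by \<open>\<pi> j\<close>, where \<open>\<pi>\<close> are the Poisson weights, the Stein equation
  \<open>\<nu> g(j + 1) - j g(j) = [j = k] - \<pi> k\<close> says that \<open>\<nu> \<pi>(j) g(j + 1)\<close> has the increments
  \<open>([j = k] - \<pi> k) \<pi> j\<close>; the solution is the corresponding sum.  At 0 the empty sum makes it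
  vanish.\<close>

definition poisson_stein :: "real \<Rightarrow> nat \<Rightarrow> nat \<Rightarrow> real" where
  "poisson_stein \<nu> k n =
     (\<Sum>i<n. (of_bool (i = k) - pmf (poisson_pmf \<nu>) k) * pmf (poisson_pmf \<nu>) i)
       / (\<nu> * pmf (poisson_pmf \<nu>) (n - 1))"

lemma poisson_stein_0 [simp]: "poisson_stein \<nu> k 0 = 0"
  by (simp add: poisson_stein_def)

context
  fixes \<nu> :: real and k :: nat
  assumes nu: "0 < \<nu>"
begin

private abbreviation "p \<equiv> pmf (poisson_pmf \<nu>)"
private abbreviation "g \<equiv> poisson_stein \<nu> k"

private lemma p_pos: "0 < p n"
  using nu by simp

lemma poisson_stein_equation:
  "\<nu> * poisson_stein \<nu> k (Suc n) - real n * poisson_stein \<nu> k n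
     = of_bool (n = k) - pmf (poisson_pmf \<nu>) k"
proof -
  let ?h = "\<lambda>i. (of_bool (i = k) - p k) * p i"
  have suc: "\<nu> * p n * g (Suc n) = (\<Sum>i<Suc n. ?h i)"
    using nu p_pos[of n] by (simp add: poisson_stein_def del: pmf_poisson sum.lessThan_Suc)
  have "real n * p n * g n = (\<Sum>i<n. ?h i)"
  proof (cases n)
    case (Suc m)
    have "real n * p n = \<nu> * p m"
      unfolding Suc by (rule poisson_weight_Suc[OF nu])
    then show ?thesis
      using Suc nu p_pos[of m] by (simp add: poisson_stein_def del: pmf_poisson sum.lessThan_Suc)
  qed simp
  with suc have "p n * (\<nu> * g (Suc n) - real n * g n) = p n * (of_bool (n = k) - p k)"
    by (simp add: algebra_simps del: pmf_poisson)
  then show ?thesis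
    using p_pos[of n] by simp
qed

text \<open>Below \<open>k\<close> the equation reads \<open>\<nu> g(n + 1) = n g(n) - \<pi> k\<close>, so that a solution that
  starts at 0 and has decreased up to \<open>n\<close> decreases further.\<close>

lemma poisson_stein_decreasing_below:
  assumes "n < k"
  shows "poisson_stein \<nu> k (Suc n) \<le> poisson_stein \<nu> k n \<and> poisson_stein \<nu> k (Suc n) \<le> 0"
  using assms
proof (induction n)
  case 0
  have "\<nu> * g (Suc 0) \<le> 0"
    using poisson_stein_equation[of 0] 0 p_pos[of k] by (simp del: pmf_poisson)
  then show ?case using nu by (simp add: mult_le_0_iff)
next
  case (Suc n)
  then have IH: "g (Suc n) \<le> g n" "g (Suc n) \<le> 0" by auto
  have e1: "\<nu> * g (Suc (Suc n)) = real (Suc n) * g (Suc n) - p k"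
    using poisson_stein_equation[of "Suc n"] Suc.prems by simp
  have e2: "\<nu> * g (Suc n) = real n * g n - p k"
    using poisson_stein_equation[of n] Suc.prems by simp
  have "real n * g (Suc n) \<le> real n * g n"
    using IH by (intro mult_left_mono) auto
  then have "real (Suc n) * g (Suc n) \<le> real n * g n"
    using IH by (simp add: algebra_simps)
  with e1 e2 have "\<nu> * g (Suc (Suc n)) \<le> \<nu> * g (Suc n)" by linarith
  then have "g (Suc (Suc n)) \<le> g (Suc n)" using nu by simp
  with IH show ?case by linarith
qed

lemma poisson_stein_nonpos:
  assumes "n \<le> k"
  shows "poisson_stein \<nu> k n \<le> 0"
  using assms poisson_stein_decreasing_below[of "n - 1"] by (cases n) auto

text \<open>Since the increments \<open>([i = k] - \<pi> k) \<pi> i\<close> add up to 0, the solution above \<open>k\<close> can be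
  rewritten in terms of the tail of the Poisson law.\<close>

private abbreviation "tail n \<equiv> (\<Sum>i. p (i + n))"

private lemma poisson_stein_above:
  assumes "k < n"
  shows "g n = p k * tail n / (\<nu> * p (n - 1))"
proof -
  have "(\<Sum>i<n. (of_bool (i = k) - p k) * p i) = p k * (1 - (\<Sum>i<n. p i))"
  proof -
    have "(\<Sum>i<n. of_bool (i = k) * p i) = p k"
      using assms sum.delta[of "{..<n}" k p] by (simp add: of_bool_def if_distrib if_distribR cong: if_cong del: pmf_poisson)
    then show ?thesis
      by (simp add: algebra_simps sum_subtractf sum_distrib_left del: pmf_poisson)
  qed
  also have "1 - (\<Sum>i<n. p i) = tail n"
    using suminf_split_initial_segment[of p n] poisson_weights_sums[OF nu]
    by (simp add: sums_iff del: pmf_poisson)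
  finally show ?thesis
    by (simp add: poisson_stein_def del: pmf_poisson)
qed

private lemma summable_tail: "summable (\<lambda>i. p (i + n))"
  using poisson_weights_sums[OF nu] by (subst summable_iff_shift) (rule sums_summable)

lemma poisson_stein_nonneg:
  assumes "k < n"
  shows "0 \<le> poisson_stein \<nu> k n"
  unfolding poisson_stein_above[OF assms] using nu
  by (intro divide_nonneg_nonneg mult_nonneg_nonneg suminf_nonneg summable_tail) (auto simp del: pmf_poisson)

text \<open>Log-concavity of the Poisson weights, \<open>\<pi>(i + n + 1) \<pi>(n - 1) \<le> \<pi>(i + n) \<pi>(n)\<close>, summed
  over \<open>i\<close>.\<close>

lemma poisson_stein_decreasing_above:
  assumes "k < n"
  shows "poisson_stein \<nu> k (Suc n) \<le> poisson_stein \<nu> k n"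
proof -
  obtain m where m: "n = Suc m" using assms by (cases n) auto
  have "p (i + Suc n) * p m \<le> p (i + n) * p n" for i
  proof -
    have a: "real (Suc (i + n)) * p (i + Suc n) = \<nu> * p (i + n)"
      using poisson_weight_Suc[OF nu, of "i + n"] by simp
    have b: "real n * p n = \<nu> * p m"
      using poisson_weight_Suc[OF nu, of m] m by simp
    have "real n * (p (i + Suc n) * p m) \<le> real (Suc (i + n)) * p (i + Suc n) * p m"
      unfolding mult.assoc by (intro mult_right_mono mult_nonneg_nonneg) auto
    also have "\<dots> = p (i + n) * (\<nu> * p m)"
      unfolding a by (simp only: mult_ac)
    also have "\<dots> = real n * (p (i + n) * p n)"
      unfolding b[symmetric] by (simp only: mult_ac)
    finally show ?thesis
      by (rule mult_left_le_imp_le) (use m in simp)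
  qed
  then have "(\<Sum>i. p (i + Suc n) * p m) \<le> (\<Sum>i. p (i + n) * p n)"
    by (intro suminf_le summable_mult2 summable_tail)
  then have "tail (Suc n) * p m \<le> tail n * p n"
    by (simp only: suminf_mult2[OF summable_tail, symmetric])
  then have "tail (Suc n) / p n \<le> tail n / p m"
    by (intro divide_right_mono frac_le_eq[THEN iffD2]) (use p_pos[of n] p_pos[of m] in \<open>auto simp: field_simps simp del: pmf_poisson\<close>)
  then have "p k / \<nu> * (tail (Suc n) / p n) \<le> p k / \<nu> * (tail n / p m)"
    using nu by (intro mult_left_mono) auto
  then show ?thesis
    using assms m by (simp add: poisson_stein_above mult_ac del: pmf_poisson)
qed

text \<open>The equation at \<open>k\<close> gives \<open>\<nu> (g(k + 1) - g(k)) = 1 - \<pi> k + (\<nu> - k) \<bar>g(k)\<bar>\<close>, and the one at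
  \<open>k - 1\<close> together with monotonicity gives \<open>(\<nu> - k + 1) \<bar>g(k)\<bar> \<le> \<pi> k\<close>.\<close>

lemma poisson_stein_jump:
  "poisson_stein \<nu> k (Suc k) - poisson_stein \<nu> k k \<le> 1 / \<nu>"
proof -
  have gk: "g k \<le> 0" by (rule poisson_stein_nonpos) simp
  have "(real k - \<nu>) * g k \<le> p k"
  proof (cases k)
    case (Suc m)
    have e: "\<nu> * g k = real m * g m - p k"
      using poisson_stein_equation[of m] Suc by simp
    have "real m * g k \<le> real m * g m"
      using poisson_stein_decreasing_below[of m] Suc by (intro mult_left_mono) auto
    then have "real k * g k \<le> real m * g m + g k" using Suc by (simp add: algebra_simps)
    with e gk show ?thesis unfolding left_diff_distrib by linarith
  qed (simp_all del: pmf_poisson)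
  moreover have "\<nu> * g (Suc k) = 1 - p k + real k * g k"
    using poisson_stein_equation[of k] by simp
  ultimately have "\<nu> * (g (Suc k) - g k) \<le> 1"
    unfolding left_diff_distrib right_diff_distrib by linarith
  then show ?thesis using nu by (simp add: field_simps)
qed

text \<open>No difference of the solution is positive except the one at \<open>k\<close>, and the solution goes from 0 to
  nonnegative values.  Hence the absolute sum of the other differences is no larger than the jump at
  \<open>k\<close>.\<close>

lemma sum_abs_poisson_stein_differences_off_peak:
  assumes "finite A" "k \<notin> A"
  shows "(\<Sum>n\<in>A. \<bar>poisson_stein \<nu> k (Suc n) - poisson_stein \<nu> k n\<bar>) \<le> 1 / \<nu>"
proof -
  define N where "N = Suc (Max (insert k A))"
  have k: "k < N" and A: "A \<subseteq> {..<N} - {k}"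
    using assms by (auto simp: N_def less_Suc_eq_le)
  have "(\<Sum>n\<in>A. \<bar>g (Suc n) - g n\<bar>) \<le> (\<Sum>n\<in>{..<N} - {k}. \<bar>g (Suc n) - g n\<bar>)"
    using A by (intro sum_mono2) auto
  also have "\<dots> = (\<Sum>n\<in>{..<N} - {k}. - (g (Suc n) - g n))"
  proof (intro sum.cong refl)
    fix n assume "n \<in> {..<N} - {k}"
    then have "n < k \<or> k < n" by auto
    then show "\<bar>g (Suc n) - g n\<bar> = - (g (Suc n) - g n)"
      using poisson_stein_decreasing_below[of n] poisson_stein_decreasing_above[of n] by auto
  qed
  also have "\<dots> = - (\<Sum>n<N. g (Suc n) - g n) + (g (Suc k) - g k)"
    using k by (subst sum.remove[of "{..<N}" k]) (auto simp: sum_negf[symmetric])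
  also have "(\<Sum>n<N. g (Suc n) - g n) = g N"
    by (simp add: sum_lessThan_telescope)
  finally show ?thesis
    using poisson_stein_jump poisson_stein_nonneg[OF k] by linarith
qed

lemma sum_abs_poisson_stein_differences:
  assumes "finite A"
  shows "(\<Sum>n\<in>A. \<bar>poisson_stein \<nu> k (Suc n) - poisson_stein \<nu> k n\<bar>) \<le> 2 / \<nu>"
proof -
  have "\<bar>g (Suc k) - g k\<bar> \<le> 1 / \<nu>"
    using poisson_stein_jump poisson_stein_nonneg[of "Suc k"] poisson_stein_nonpos[of k] by simp
  moreover have "(\<Sum>n\<in>A. \<bar>g (Suc n) - g n\<bar>) \<le> (\<Sum>n\<in>insert k (A - {k}). \<bar>g (Suc n) - g n\<bar>)"
    using assms by (intro sum_mono2) auto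
  ultimately show ?thesis
    using assms sum_abs_poisson_stein_differences_off_peak[of "A - {k}"]
    by (simp add: insert_Diff_if del: insert_Diff_single)
qed

lemma abs_poisson_stein_difference:
  "\<bar>poisson_stein \<nu> k (Suc n) - poisson_stein \<nu> k n\<bar> \<le> 1 / \<nu>"
proof (cases "n = k")
  case True
  then show ?thesis
    using poisson_stein_jump poisson_stein_nonneg[of "Suc k"] poisson_stein_nonpos[of k] by simp
next
  case False
  then show ?thesis
    using sum_abs_poisson_stein_differences_off_peak[of "{n}"] by simp
qed

lemma abs_poisson_stein: "\<bar>poisson_stein \<nu> k n\<bar> \<le> 1 / \<nu>"
proof (cases "n \<le> k")
  case True
  have "\<bar>g n\<bar> = \<bar>\<Sum>i<n. g (Suc i) - g i\<bar>"
    by (simp add: sum_lessThan_telescope)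
  also have "\<dots> \<le> (\<Sum>i<n. \<bar>g (Suc i) - g i\<bar>)" by (rule sum_abs)
  also have "\<dots> \<le> 1 / \<nu>"
    using True by (intro sum_abs_poisson_stein_differences_off_peak) auto
  finally show ?thesis .
next
  case False
  then have "Suc k \<le> n" by simp
  then have "g n \<le> g (Suc k)"
  proof (induction n rule: dec_induct)
    case (step n)
    then show ?case using poisson_stein_decreasing_above[of n] by simp
  qed simp
  moreover have "g (Suc k) \<le> 1 / \<nu>"
    using poisson_stein_jump poisson_stein_nonpos[of k] by simp
  ultimately show ?thesis
    using False poisson_stein_nonneg[of n] by simp
qed

end

text \<open>The solution is extended by 0 to the negative integers.\<close>

lemma sum_abs_int_poisson_stein_differences:
  fixes A :: "int set"
  assumes "0 < \<nu>" "finite A"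
  shows "(\<Sum>j\<in>A. \<bar>poisson_stein \<nu> k (nat (j + 1)) - poisson_stein \<nu> k (nat j)\<bar>) \<le> 2 / \<nu>"
proof -
  let ?g = "poisson_stein \<nu> k"
  have "(\<Sum>j\<in>A. \<bar>?g (nat (j + 1)) - ?g (nat j)\<bar>)
      = (\<Sum>j\<in>{j\<in>A. 0 \<le> j}. \<bar>?g (nat (j + 1)) - ?g (nat j)\<bar>)"
    using assms by (intro sum.mono_neutral_right) (auto simp: not_le, smt (verit) nat_le_0)
  also have "\<dots> = (\<Sum>n\<in>nat ` {j\<in>A. 0 \<le> j}. \<bar>?g (Suc n) - ?g n\<bar>)"
    by (subst sum.reindex) (auto simp: inj_on_def nat_add_distrib intro!: sum.cong)
  also have "\<dots> \<le> 2 / \<nu>"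
    using assms by (intro sum_abs_poisson_stein_differences) auto
  finally show ?thesis .
qed

lemma abs_int_poisson_stein_difference:
  fixes j :: int
  assumes "0 < \<nu>"
  shows "\<bar>poisson_stein \<nu> k (nat (j + 1)) - poisson_stein \<nu> k (nat j)\<bar> \<le> 1 / \<nu>"
  using abs_poisson_stein_difference[OF assms, of k "nat j"] assms
  by (cases "0 \<le> j") (auto simp: nat_add_distrib)

section \<open>Integrals of functions of integer-valued random variables\<close>

lemma square_le_of_abs_le: "x\<^sup>2 \<le> c\<^sup>2" if "\<bar>x\<bar> \<le> c" for x c :: real
  using power_mono[OF that, of 2] by simp

lemma abs_power2_le: "\<bar>x\<^sup>2\<bar> \<le> c\<^sup>2" if "\<bar>x\<bar> \<le> c" for x c :: real
  using square_le_of_abs_le[OF that] by simp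

lemma integrable_mult_of_squares:
  fixes f g :: "'a \<Rightarrow> real"
  assumes [measurable]: "f \<in> borel_measurable M" "g \<in> borel_measurable M"
    and "integrable M (\<lambda>x. (f x)\<^sup>2)" "integrable M (\<lambda>x. (g x)\<^sup>2)"
  shows "integrable M (\<lambda>x. f x * g x)"
proof (rule Bochner_Integration.integrable_bound)
  show "integrable M (\<lambda>x. (f x)\<^sup>2 + (g x)\<^sup>2)"
    using assms by simp
  show "AE x in M. norm (f x * g x) \<le> norm ((f x)\<^sup>2 + (g x)\<^sup>2)"
  proof (rule AE_I2)
    fix x
    have "2 * (\<bar>f x\<bar> * \<bar>g x\<bar>) \<le> (f x)\<^sup>2 + (g x)\<^sup>2"
      using sum_squares_bound[of "\<bar>f x\<bar>" "\<bar>g x\<bar>"] by (simp add: mult.assoc)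
    moreover have "0 \<le> \<bar>f x\<bar> * \<bar>g x\<bar>" by simp
    ultimately show "norm (f x * g x) \<le> norm ((f x)\<^sup>2 + (g x)\<^sup>2)"
      unfolding real_norm_def abs_mult by linarith
  qed
qed simp

text \<open>The Cauchy-Schwarz inequality, obtained by integrating \<open>s f\<^sup>2 + g\<^sup>2 / s \<ge> 2 \<bar>f g\<bar>\<close> with the \<open>s\<close>
  that balances the two terms.\<close>

lemma abs_integral_mult_le:
  fixes f g :: "'a \<Rightarrow> real"
  assumes [measurable]: "f \<in> borel_measurable M" "g \<in> borel_measurable M"
    and f2: "integrable M (\<lambda>x. (f x)\<^sup>2)" and g2: "integrable M (\<lambda>x. (g x)\<^sup>2)"
  shows "\<bar>\<integral>x. f x * g x \<partial>M\<bar> \<le> sqrt (\<integral>x. (f x)\<^sup>2 \<partial>M) * sqrt (\<integral>x. (g x)\<^sup>2 \<partial>M)"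
proof -
  define A where "A = (\<integral>x. (f x)\<^sup>2 \<partial>M)"
  define B where "B = (\<integral>x. (g x)\<^sup>2 \<partial>M)"
  have fg: "integrable M (\<lambda>x. f x * g x)"
    by (rule integrable_mult_of_squares) (use f2 g2 in auto)
  have nonneg: "0 \<le> A" "0 \<le> B" by (simp_all add: A_def B_def)
  have zero: "\<bar>\<integral>x. f x * g x \<partial>M\<bar> = 0" if "A = 0 \<or> B = 0"
  proof -
    have "AE x in M. f x * g x = 0"
      using that integral_nonneg_eq_0_iff_AE[OF f2] integral_nonneg_eq_0_iff_AE[OF g2]
      by (auto simp: A_def B_def)
    then have "(\<integral>x. f x * g x \<partial>M) = 0"
      by (rule integral_eq_zero_AE)
    then show ?thesis by simp
  qed
  show ?thesis
  proof (cases "A = 0 \<or> B = 0")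
    case True
    then show ?thesis
      using zero nonneg unfolding A_def[symmetric] B_def[symmetric] by simp
  next
    case False
    then have pos: "0 < A" "0 < B" using nonneg by auto
    define s where "s = sqrt B / sqrt A"
    have s: "0 < s" using pos by (simp add: s_def)
    have pt: "\<bar>f x * g x\<bar> \<le> (s * (f x)\<^sup>2 + (g x)\<^sup>2 / s) / 2" for x
    proof -
      have "0 \<le> (s * \<bar>f x\<bar> - \<bar>g x\<bar>)\<^sup>2 / s" using s by simp
      also have "\<dots> = s * (f x)\<^sup>2 + (g x)\<^sup>2 / s - 2 * \<bar>f x * g x\<bar>"
        using s by (simp add: power2_diff field_simps power2_eq_square abs_mult)
      finally show ?thesis by simp
    qed
    have "\<bar>\<integral>x. f x * g x \<partial>M\<bar> \<le> (\<integral>x. \<bar>f x * g x\<bar> \<partial>M)"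
      by (rule integral_abs_bound)
    also have "\<dots> \<le> (\<integral>x. (s * (f x)\<^sup>2 + (g x)\<^sup>2 / s) / 2 \<partial>M)"
      using f2 g2 s by (intro integral_mono pt integrable_abs fg) auto
    also have "\<dots> = (s * A + B / s) / 2"
      using f2 g2 by (simp add: A_def B_def)
    also have "\<dots> = sqrt A * sqrt B"
    proof -
      have "s * A = sqrt A * sqrt B"
        using pos by (simp add: s_def field_simps flip: power2_eq_square)
      moreover have "B / s = sqrt A * sqrt B"
        using pos by (simp add: s_def field_simps flip: power2_eq_square)
      ultimately show ?thesis by simp
    qed
    finally show ?thesis unfolding A_def B_def .
  qed
qed

text \<open>A sum over the integers is the limit of its parts over \<open>{-N..N}\<close>; this makes the
  expectation of \<open>f(W)\<close> the limit of finite sums weighted with the point probabilities.\<close>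

lemma (in prob_space) expectation_le_by_atoms:
  fixes W :: "'a \<Rightarrow> int" and f h :: "int \<Rightarrow> real"
  assumes [measurable]: "W \<in> M \<rightarrow>\<^sub>M count_space UNIV"
    and int: "integrable M (\<lambda>\<omega>. f (W \<omega>))"
    and C: "0 \<le> C" and atoms: "\<And>k. f k * prob {\<omega>\<in>space M. W \<omega> = k} \<le> C * h k"
    and sums: "\<And>A. finite A \<Longrightarrow> sum h A \<le> B"
  shows "expectation (\<lambda>\<omega>. f (W \<omega>)) \<le> C * B"
proof -
  let ?F = "\<lambda>N::nat. \<lambda>\<omega>. f (W \<omega>) * of_bool (\<bar>W \<omega>\<bar> \<le> int N)"
  have lim: "(\<lambda>N. expectation (?F N)) \<longlonglongrightarrow> expectation (\<lambda>\<omega>. f (W \<omega>))"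
  proof (rule integral_dominated_convergence[where w = "\<lambda>\<omega>. \<bar>f (W \<omega>)\<bar>"])
    show "AE \<omega> in M. (\<lambda>N. ?F N \<omega>) \<longlonglongrightarrow> f (W \<omega>)"
    proof (rule AE_I2)
      fix \<omega>
      have "\<forall>\<^sub>F N in sequentially. ?F N \<omega> = f (W \<omega>)"
        using eventually_ge_at_top[of "nat \<bar>W \<omega>\<bar>"] by eventually_elim auto
      then show "(\<lambda>N. ?F N \<omega>) \<longlonglongrightarrow> f (W \<omega>)"
        by (rule tendsto_eventually)
    qed
  next
    show "?F N \<in> borel_measurable M" for N
      by (rule measurable_compose[OF assms(1)]) simp
  qed (use int in auto)
  have "expectation (?F N) \<le> C * B" for N
  proof -
    let ?I = "{- int N..int N}"
    have "?F N = (\<lambda>\<omega>. \<Sum>k\<in>?I. f k * of_bool (W \<omega> = k))"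
    proof
      fix \<omega>
      have "(\<Sum>k\<in>?I. f k * of_bool (W \<omega> = k)) = (\<Sum>k\<in>?I. if W \<omega> = k then f k else 0)"
        by (intro sum.cong) auto
      then show "?F N \<omega> = (\<Sum>k\<in>?I. f k * of_bool (W \<omega> = k))"
        by auto
    qed
    then have "expectation (?F N) = expectation (\<lambda>\<omega>. \<Sum>k\<in>?I. f k * of_bool (W \<omega> = k))"
      by (rule arg_cong)
    also have "\<dots> = (\<Sum>k\<in>?I. expectation (\<lambda>\<omega>. f k * of_bool (W \<omega> = k)))"
      by (intro Bochner_Integration.integral_sum integrable_mult_right
          integrable_const_bound[where B = 1]) auto
    also have "\<dots> = (\<Sum>k\<in>?I. f k * prob {\<omega>\<in>space M. W \<omega> = k})"
    proof (intro sum.cong refl)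
      fix k
      have "expectation (\<lambda>\<omega>. of_bool (W \<omega> = k)) = expectation (indicator {\<omega>\<in>space M. W \<omega> = k})"
        by (intro Bochner_Integration.integral_cong) (auto simp: indicator_def)
      also have "\<dots> = prob ({\<omega>\<in>space M. W \<omega> = k} \<inter> space M)"
        by (rule Bochner_Integration.integral_indicator)
      also have "{\<omega>\<in>space M. W \<omega> = k} \<inter> space M = {\<omega>\<in>space M. W \<omega> = k}"
        by auto
      finally show "expectation (\<lambda>\<omega>. f k * of_bool (W \<omega> = k)) = f k * prob {\<omega>\<in>space M. W \<omega> = k}"
        by simp
    qed
    also have "\<dots> \<le> (\<Sum>k\<in>?I. C * h k)"
      by (intro sum_mono atoms)
    also have "\<dots> \<le> C * B"
      unfolding sum_distrib_left[symmetric] using C sums[of ?I] by (intro mult_left_mono) auto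
    finally show ?thesis .
  qed
  then show ?thesis
    by (intro LIMSEQ_le_const2[OF lim]) auto
qed

lemma exchangeable_pair_swap:
  fixes X Y :: "'a \<Rightarrow> int" and h :: "int \<Rightarrow> int \<Rightarrow> real"
  assumes [measurable]: "X \<in> M \<rightarrow>\<^sub>M count_space UNIV" "Y \<in> M \<rightarrow>\<^sub>M count_space UNIV"
    and ex: "exchangeable_pair M X Y"
  shows "integrable M (\<lambda>\<omega>. h (X \<omega>) (Y \<omega>)) \<longleftrightarrow> integrable M (\<lambda>\<omega>. h (Y \<omega>) (X \<omega>))"
    and "(\<integral>\<omega>. h (X \<omega>) (Y \<omega>) \<partial>M) = (\<integral>\<omega>. h (Y \<omega>) (X \<omega>) \<partial>M)"
proof -
  let ?N = "count_space UNIV \<Otimes>\<^sub>M count_space UNIV :: (int \<times> int) measure"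
  have N: "?N = count_space UNIV"
    by (simp add: pair_measure_countable)
  have meas: "case_prod h \<in> borel_measurable ?N"
    unfolding N by simp
  have [measurable]: "(\<lambda>\<omega>. (X \<omega>, Y \<omega>)) \<in> M \<rightarrow>\<^sub>M ?N" "(\<lambda>\<omega>. (Y \<omega>, X \<omega>)) \<in> M \<rightarrow>\<^sub>M ?N"
    by measurable
  have "integrable (distr M ?N (\<lambda>\<omega>. (X \<omega>, Y \<omega>))) (case_prod h)
      = integrable (distr M ?N (\<lambda>\<omega>. (Y \<omega>, X \<omega>))) (case_prod h)"
    using ex unfolding exchangeable_pair_def by simp
  then show "integrable M (\<lambda>\<omega>. h (X \<omega>) (Y \<omega>)) \<longleftrightarrow> integrable M (\<lambda>\<omega>. h (Y \<omega>) (X \<omega>))"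
    by (subst (asm) (1 2) integrable_distr_eq) (auto simp: meas)
  have "integral\<^sup>L (distr M ?N (\<lambda>\<omega>. (X \<omega>, Y \<omega>))) (case_prod h)
      = integral\<^sup>L (distr M ?N (\<lambda>\<omega>. (Y \<omega>, X \<omega>))) (case_prod h)"
    using ex unfolding exchangeable_pair_def by simp
  then show "(\<integral>\<omega>. h (X \<omega>) (Y \<omega>) \<partial>M) = (\<integral>\<omega>. h (Y \<omega>) (X \<omega>) \<partial>M)"
    by (subst (asm) (1 2) integral_distr) (auto simp: meas)
qed

lemma (in prob_space) sigma_finite_subalgebra_vimage:
  fixes X :: "'a \<Rightarrow> int"
  assumes "X \<in> M \<rightarrow>\<^sub>M count_space UNIV"
  shows "sigma_finite_subalgebra M (vimage_algebra (space M) X (count_space UNIV))"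
proof -
  have "subalgebra M (vimage_algebra (space M) X (count_space UNIV))"
    unfolding subalgebra_def using assms
    by (auto simp: sets_vimage_algebra2 measurable_sets)
  then have "finite_measure_subalgebra M (vimage_algebra (space M) X (count_space UNIV))"
    by unfold_locales auto
  then show ?thesis
    by (rule finite_measure_subalgebra_is_sigma_finite)
qed

lemma (in prob_space) cond_exp_given_mult:
  fixes X :: "'a \<Rightarrow> int" and \<phi> :: "int \<Rightarrow> real"
  assumes X: "X \<in> M \<rightarrow>\<^sub>M count_space UNIV" and f: "f \<in> borel_measurable M"
    and int: "integrable M (\<lambda>\<omega>. \<phi> (X \<omega>) * f \<omega>)"
  shows "integrable M (\<lambda>\<omega>. \<phi> (X \<omega>) * cond_exp_given M X f \<omega>)"
    and "expectation (\<lambda>\<omega>. \<phi> (X \<omega>) * cond_exp_given M X f \<omega>) = expectation (\<lambda>\<omega>. \<phi> (X \<omega>) * f \<omega>)"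
proof -
  interpret sigma_finite_subalgebra M "vimage_algebra (space M) X (count_space UNIV)"
    by (rule sigma_finite_subalgebra_vimage[OF X])
  have "X \<in> vimage_algebra (space M) X (count_space UNIV) \<rightarrow>\<^sub>M count_space UNIV"
    by (rule measurable_vimage_algebra1) simp
  then have "(\<lambda>\<omega>. \<phi> (X \<omega>)) \<in> borel_measurable (vimage_algebra (space M) X (count_space UNIV))"
    by (rule measurable_compose) simp
  from real_cond_exp_intg[OF int this f]
  show "integrable M (\<lambda>\<omega>. \<phi> (X \<omega>) * cond_exp_given M X f \<omega>)"
    and "expectation (\<lambda>\<omega>. \<phi> (X \<omega>) * cond_exp_given M X f \<omega>) = expectation (\<lambda>\<omega>. \<phi> (X \<omega>) * f \<omega>)"
    by (simp_all add: cond_exp_given_def)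
qed

section \<open>Exchangeable pairs with unit steps and approximate linear regression\<close>

locale unit_step_pair = prob_space M for M :: "'a measure" +
  fixes W W' :: "'a \<Rightarrow> int" and R S :: "'a \<Rightarrow> real" and \<mu> \<sigma> lam :: real
  assumes W_measurable [measurable]: "W \<in> M \<rightarrow>\<^sub>M count_space UNIV"
    and W'_measurable [measurable]: "W' \<in> M \<rightarrow>\<^sub>M count_space UNIV"
    and exchangeable: "exchangeable_pair M W W'"
    and integrable_W: "integrable M (\<lambda>\<omega>. real_of_int (W \<omega>))"
    and expectation_W: "expectation (\<lambda>\<omega>. real_of_int (W \<omega>)) = \<mu>"
    and integrable_W2: "integrable M (\<lambda>\<omega>. (real_of_int (W \<omega>) - \<mu>)\<^sup>2)"
    and variance_W: "variance (\<lambda>\<omega>. real_of_int (W \<omega>)) = \<sigma>\<^sup>2"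
    and sigma_pos: "0 < \<sigma>" and lam_pos: "0 < lam"
    and R_measurable [measurable]: "R \<in> borel_measurable M"
    and regression: "AE \<omega> in M. cond_exp_given M W (\<lambda>\<omega>. real_of_int (W' \<omega>) - \<mu>) \<omega> =
           (1 - lam) * (real_of_int (W \<omega>) - \<mu>) + R \<omega>"
    and unit_steps: "AE \<omega> in M. W' \<omega> - W \<omega> \<in> {-1, 0, 1}"
    and S_eq: "S = cond_prob_given M W (\<lambda>\<omega>. W' \<omega> = W \<omega> + 1)"
begin

definition q :: real where
  "q = (SUP k. prob {\<omega>\<in>space M. W \<omega> = k})"

lemma prob_atom_le_q: "prob {\<omega>\<in>space M. W \<omega> = k} \<le> q"
  unfolding q_def by (intro cSUP_upper bdd_aboveI2[where M = 1]) auto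

lemma q_nonneg: "0 \<le> q"
  using prob_atom_le_q[of 0] measure_nonneg order_trans by blast

lemma measurable_fun_W: "(\<lambda>\<omega>. \<phi> (W \<omega>)) \<in> borel_measurable M" for \<phi> :: "int \<Rightarrow> real"
  by (rule measurable_compose[OF W_measurable]) simp

lemma integrable_fun_W:
  fixes \<phi> :: "int \<Rightarrow> real"
  assumes "\<And>k. \<bar>\<phi> k\<bar> \<le> C"
  shows "integrable M (\<lambda>\<omega>. \<phi> (W \<omega>))"
  using assms by (intro integrable_const_bound[where B = C]) auto

lemma integrable_centred: "integrable M (\<lambda>\<omega>. real_of_int (W \<omega>) - \<mu>)"
  using integrable_W by simp

lemma expectation_centred: "expectation (\<lambda>\<omega>. real_of_int (W \<omega>) - \<mu>) = 0"
  using integrable_W expectation_W by (simp add: prob_space)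

lemma expectation_centred2: "expectation (\<lambda>\<omega>. (real_of_int (W \<omega>) - \<mu>)\<^sup>2) = \<sigma>\<^sup>2"
  using variance_W expectation_W by simp

lemma S_measurable [measurable]: "S \<in> borel_measurable M"
  unfolding S_eq cond_prob_given_def cond_exp_given_def by measurable

lemma S_range: "AE \<omega> in M. 0 \<le> S \<omega> \<and> S \<omega> \<le> 1"
proof -
  interpret sigma_finite_subalgebra M "vimage_algebra (space M) W (count_space UNIV)"
    by (rule sigma_finite_subalgebra_vimage) measurable
  let ?U = "indicator {\<omega>\<in>space M. W' \<omega> = W \<omega> + 1} :: 'a \<Rightarrow> real"
  have U: "integrable M ?U"
    by (intro integrable_const_bound[where B = 1]) auto
  show ?thesis
    using real_cond_exp_ge_c[OF U, of 0] real_cond_exp_le_c[OF U, of 1]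
    unfolding S_eq cond_prob_given_def cond_exp_given_def by auto
qed

lemma integrable_S: "integrable M S"
  using S_range by (intro integrable_const_bound[where B = 1]) auto

lemma integrable_S_centred2: "integrable M (\<lambda>\<omega>. (S \<omega> - expectation S)\<^sup>2)"
proof (rule integrable_const_bound[where B = "(1 + \<bar>expectation S\<bar>)\<^sup>2"])
  show "AE \<omega> in M. norm ((S \<omega> - expectation S)\<^sup>2) \<le> (1 + \<bar>expectation S\<bar>)\<^sup>2"
    using S_range
  proof eventually_elim
    case (elim \<omega>)
    then have "\<bar>S \<omega> - expectation S\<bar> \<le> \<bar>1 + \<bar>expectation S\<bar>\<bar>" by linarith
    then show ?case unfolding abs_le_square_iff by simp
  qed
qed measurable

text \<open>\<open>R\<close> is almost surely \<open>\<E>[W' - W | W] + lam (W - \<mu>)\<close>, whose first summand is bounded.\<close>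

lemma integrable_R2: "integrable M (\<lambda>\<omega>. (R \<omega>)\<^sup>2)"
proof -
  interpret sigma_finite_subalgebra M "vimage_algebra (space M) W (count_space UNIV)"
    by (rule sigma_finite_subalgebra_vimage) measurable
  let ?E = "real_cond_exp M (vimage_algebra (space M) W (count_space UNIV))"
  let ?D = "\<lambda>\<omega>. real_of_int (W' \<omega>) - real_of_int (W \<omega>)"
  let ?w = "\<lambda>\<omega>. real_of_int (W \<omega>) - \<mu>"
  have D: "AE \<omega> in M. \<bar>?D \<omega>\<bar> \<le> 1"
    using unit_steps by eventually_elim auto
  have Dint: "integrable M ?D"
    using D by (intro integrable_const_bound[where B = 1]) auto
  have "W \<in> vimage_algebra (space M) W (count_space UNIV) \<rightarrow>\<^sub>M count_space UNIV"
    by (rule measurable_vimage_algebra1) simp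
  then have wF: "?w \<in> borel_measurable (vimage_algebra (space M) W (count_space UNIV))"
    by (rule measurable_compose) simp
  have "AE \<omega> in M. ?E (\<lambda>\<omega>. ?D \<omega> + ?w \<omega>) \<omega> = ?E ?D \<omega> + ?E ?w \<omega>"
    by (rule real_cond_exp_add[OF Dint integrable_centred])
  moreover have "(\<lambda>\<omega>. ?D \<omega> + ?w \<omega>) = (\<lambda>\<omega>. real_of_int (W' \<omega>) - \<mu>)"
    by auto
  ultimately have sum: "AE \<omega> in M. ?E (\<lambda>\<omega>. real_of_int (W' \<omega>) - \<mu>) \<omega> = ?E ?D \<omega> + ?E ?w \<omega>"
    by simp
  have w: "AE \<omega> in M. ?E ?w \<omega> = ?w \<omega>"
    by (rule real_cond_exp_F_meas[OF integrable_centred wF])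
  have lo: "AE \<omega> in M. -1 \<le> ?E ?D \<omega>"
    by (rule real_cond_exp_ge_c[OF Dint]) (use D in eventually_elim, auto)
  have up: "AE \<omega> in M. ?E ?D \<omega> \<le> 1"
    by (rule real_cond_exp_le_c[OF Dint]) (use D in eventually_elim, auto)
  have "AE \<omega> in M. norm ((R \<omega>)\<^sup>2) \<le> norm (2 + 2 * lam\<^sup>2 * (?w \<omega>)\<^sup>2)"
    using regression sum w lo up unfolding cond_exp_given_def
  proof eventually_elim
    case (elim \<omega>)
    define e where "e = ?E ?D \<omega>"
    have R: "R \<omega> = e + lam * ?w \<omega>"
      using elim by (simp add: e_def algebra_simps)
    have e: "e\<^sup>2 \<le> 1"
      using elim by (simp add: e_def abs_square_le_1 abs_le_iff)
    have "(R \<omega>)\<^sup>2 \<le> 2 * e\<^sup>2 + 2 * (lam * ?w \<omega>)\<^sup>2"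
      unfolding R using zero_le_power2[of "e - lam * ?w \<omega>"]
      by (simp add: power2_sum power2_diff)
    also have "\<dots> \<le> 2 + 2 * lam\<^sup>2 * (?w \<omega>)\<^sup>2"
      using e by (simp add: power_mult_distrib)
    finally show ?case by simp
  qed
  moreover have "integrable M (\<lambda>\<omega>. 2 + 2 * lam\<^sup>2 * (?w \<omega>)\<^sup>2)"
    using integrable_W2 by simp
  ultimately show ?thesis
    by (intro Bochner_Integration.integrable_bound[of M _ "\<lambda>\<omega>. (R \<omega>)\<^sup>2"]) auto
qed

text \<open>By exchangeability, downward steps contribute \<open>\<E>[\<phi>(W); W' = W - 1] = \<E>[\<phi>(W'); W' = W + 1]\<close>,
  so \<open>\<E>[(W' - W) \<phi>(W)] = - \<E>[S (\<phi>(W + 1) - \<phi>(W))]\<close>.  The left-hand side is also given by the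
  regression condition.\<close>

lemma pair_identity:
  fixes \<phi> :: "int \<Rightarrow> real"
  assumes \<phi>2: "integrable M (\<lambda>\<omega>. (\<phi> (W \<omega>))\<^sup>2)"
    and bound: "\<And>k. \<bar>\<phi> (k + 1) - \<phi> k\<bar> \<le> C"
  shows "lam * expectation (\<lambda>\<omega>. (real_of_int (W \<omega>) - \<mu>) * \<phi> (W \<omega>))
    = expectation (\<lambda>\<omega>. R \<omega> * \<phi> (W \<omega>))
      + expectation (\<lambda>\<omega>. S \<omega> * (\<phi> (W \<omega> + 1) - \<phi> (W \<omega>)))"
proof -
  let ?w = "\<lambda>\<omega>. real_of_int (W \<omega>) - \<mu>"
  let ?w' = "\<lambda>\<omega>. real_of_int (W' \<omega>) - \<mu>"
  let ?X = "cond_exp_given M W ?w'"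
  let ?U = "indicator {\<omega>\<in>space M. W' \<omega> = W \<omega> + 1} :: 'a \<Rightarrow> real"
  have int_w'2: "integrable M (\<lambda>\<omega>. (?w' \<omega>)\<^sup>2)"
    using exchangeable_pair_swap(1)[OF W_measurable W'_measurable exchangeable,
        of "\<lambda>x y. (real_of_int x - \<mu>)\<^sup>2"] integrable_W2 by simp
  have int_w\<phi>: "integrable M (\<lambda>\<omega>. \<phi> (W \<omega>) * ?w \<omega>)"
    by (rule integrable_mult_of_squares) (use \<phi>2 integrable_W2 in auto)
  have int_w'\<phi>: "integrable M (\<lambda>\<omega>. \<phi> (W \<omega>) * ?w' \<omega>)"
    by (rule integrable_mult_of_squares) (use \<phi>2 int_w'2 in auto)
  have int_\<phi>: "integrable M (\<lambda>\<omega>. \<phi> (W \<omega>))"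
    by (rule square_integrable_imp_integrable[OF measurable_fun_W \<phi>2])
  have int_\<phi>': "integrable M (\<lambda>\<omega>. \<phi> (W' \<omega>))"
    using exchangeable_pair_swap(1)[OF W_measurable W'_measurable exchangeable, of "\<lambda>x y. \<phi> x"] int_\<phi>
    by simp
  have X: "integrable M (\<lambda>\<omega>. \<phi> (W \<omega>) * ?X \<omega>)"
      "expectation (\<lambda>\<omega>. \<phi> (W \<omega>) * ?X \<omega>) = expectation (\<lambda>\<omega>. \<phi> (W \<omega>) * ?w' \<omega>)"
    by (rule cond_exp_given_mult[where \<phi> = \<phi>, OF W_measurable _ int_w'\<phi>]; measurable)+
  have "expectation (\<lambda>\<omega>. R \<omega> * \<phi> (W \<omega>))
      = expectation (\<lambda>\<omega>. \<phi> (W \<omega>) * ?X \<omega> - (1 - lam) * (\<phi> (W \<omega>) * ?w \<omega>))"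
  proof (rule integral_cong_AE)
    show "(\<lambda>\<omega>. \<phi> (W \<omega>) * ?X \<omega> - (1 - lam) * (\<phi> (W \<omega>) * ?w \<omega>)) \<in> borel_measurable M"
      unfolding cond_exp_given_def by measurable
    show "AE \<omega> in M. R \<omega> * \<phi> (W \<omega>) = \<phi> (W \<omega>) * ?X \<omega> - (1 - lam) * (\<phi> (W \<omega>) * ?w \<omega>)"
      using regression
    proof eventually_elim
      case (elim \<omega>)
      show ?case unfolding elim by (simp add: algebra_simps)
    qed
  qed measurable
  also have "\<dots> = expectation (\<lambda>\<omega>. \<phi> (W \<omega>) * ?w' \<omega>) - (1 - lam) * expectation (\<lambda>\<omega>. \<phi> (W \<omega>) * ?w \<omega>)"
    using X int_w\<phi> by simp
  also have "expectation (\<lambda>\<omega>. \<phi> (W \<omega>) * ?w' \<omega>)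
      = expectation (\<lambda>\<omega>. \<phi> (W \<omega>) * ?w \<omega> + \<phi> (W \<omega>) * (real_of_int (W' \<omega>) - real_of_int (W \<omega>)))"
    by (simp add: algebra_simps)
  also have "\<dots> = expectation (\<lambda>\<omega>. \<phi> (W \<omega>) * ?w \<omega>)
      + expectation (\<lambda>\<omega>. \<phi> (W \<omega>) * (real_of_int (W' \<omega>) - real_of_int (W \<omega>)))"
  proof (rule Bochner_Integration.integral_add[OF int_w\<phi>])
    have "(\<lambda>\<omega>. \<phi> (W \<omega>) * (real_of_int (W' \<omega>) - real_of_int (W \<omega>)))
        = (\<lambda>\<omega>. \<phi> (W \<omega>) * ?w' \<omega> - \<phi> (W \<omega>) * ?w \<omega>)"
      by (auto simp: algebra_simps)
    then show "integrable M (\<lambda>\<omega>. \<phi> (W \<omega>) * (real_of_int (W' \<omega>) - real_of_int (W \<omega>)))"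
      using int_w\<phi> int_w'\<phi> by simp
  qed
  finally have R\<phi>: "expectation (\<lambda>\<omega>. R \<omega> * \<phi> (W \<omega>)) = lam * expectation (\<lambda>\<omega>. ?w \<omega> * \<phi> (W \<omega>))
      + expectation (\<lambda>\<omega>. \<phi> (W \<omega>) * (real_of_int (W' \<omega>) - real_of_int (W \<omega>)))"
    by (simp add: algebra_simps)

  define up where "up = (\<lambda>x y :: int. of_bool (y = x + 1) * \<phi> x)"
  define up' where "up' = (\<lambda>x y :: int. of_bool (y = x + 1) * \<phi> y)"
  have meas [measurable]: "(\<lambda>\<omega>. up (W \<omega>) (W' \<omega>)) \<in> borel_measurable M"
      "(\<lambda>\<omega>. up' (W \<omega>) (W' \<omega>)) \<in> borel_measurable M" "(\<lambda>\<omega>. up' (W' \<omega>) (W \<omega>)) \<in> borel_measurable M"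
    unfolding up_def up'_def by measurable
  have int_up: "integrable M (\<lambda>\<omega>. up (W \<omega>) (W' \<omega>))"
    by (rule Bochner_Integration.integrable_bound[OF int_\<phi>]) (auto simp: up_def)
  have int_up': "integrable M (\<lambda>\<omega>. up' (W \<omega>) (W' \<omega>))"
    by (rule Bochner_Integration.integrable_bound[OF int_\<phi>']) (auto simp: up'_def)
  have swap: "integrable M (\<lambda>\<omega>. up' (W' \<omega>) (W \<omega>))"
      "expectation (\<lambda>\<omega>. up' (W' \<omega>) (W \<omega>)) = expectation (\<lambda>\<omega>. up' (W \<omega>) (W' \<omega>))"
    using exchangeable_pair_swap[OF W_measurable W'_measurable exchangeable, of up'] int_up' by simp_all
  have "expectation (\<lambda>\<omega>. \<phi> (W \<omega>) * (real_of_int (W' \<omega>) - real_of_int (W \<omega>)))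
      = expectation (\<lambda>\<omega>. up (W \<omega>) (W' \<omega>) - up' (W' \<omega>) (W \<omega>))"
  proof (rule integral_cong_AE)
    show "AE \<omega> in M. \<phi> (W \<omega>) * (real_of_int (W' \<omega>) - real_of_int (W \<omega>))
        = up (W \<omega>) (W' \<omega>) - up' (W' \<omega>) (W \<omega>)"
      using unit_steps
    proof eventually_elim
      case (elim \<omega>)
      then have "W' \<omega> = W \<omega> - 1 \<or> W' \<omega> = W \<omega> \<or> W' \<omega> = W \<omega> + 1" by auto
      then show ?case by (auto simp: up_def up'_def)
    qed
  qed measurable
  also have "\<dots> = - expectation (\<lambda>\<omega>. up' (W \<omega>) (W' \<omega>) - up (W \<omega>) (W' \<omega>))"
    using int_up int_up' swap by simp
  also have "expectation (\<lambda>\<omega>. up' (W \<omega>) (W' \<omega>) - up (W \<omega>) (W' \<omega>))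
      = expectation (\<lambda>\<omega>. (\<phi> (W \<omega> + 1) - \<phi> (W \<omega>)) * ?U \<omega>)"
    by (intro Bochner_Integration.integral_cong) (auto simp: up_def up'_def)
  also have "\<dots> = expectation (\<lambda>\<omega>. (\<phi> (W \<omega> + 1) - \<phi> (W \<omega>)) * S \<omega>)"
    unfolding S_eq cond_prob_given_def
  proof (rule cond_exp_given_mult(2)[OF W_measurable, of _ "\<lambda>k. \<phi> (k + 1) - \<phi> k", symmetric])
    show "integrable M (\<lambda>\<omega>. (\<phi> (W \<omega> + 1) - \<phi> (W \<omega>)) * ?U \<omega>)"
    proof (rule integrable_const_bound[where B = C])
      have "\<bar>(\<phi> (k + 1) - \<phi> k) * u\<bar> \<le> C" if "u = 0 \<or> u = 1" for k and u :: real
        using that bound[of k] by auto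
      then show "AE \<omega> in M. norm ((\<phi> (W \<omega> + 1) - \<phi> (W \<omega>)) * ?U \<omega>) \<le> C"
        by (auto simp: indicator_def)
    qed (use measurable_fun_W[of "\<lambda>k. \<phi> (k + 1) - \<phi> k"] in auto)
  qed auto
  finally show ?thesis
    using R\<phi> by (simp add: mult.commute)
qed

lemma expectation_R: "expectation R = 0"
  using pair_identity[of "\<lambda>_. 1" 0] expectation_centred by simp

lemma expectation_R_centred:
  "expectation (\<lambda>\<omega>. R \<omega> * (real_of_int (W \<omega>) - \<mu>)) = lam * \<sigma>\<^sup>2 - expectation S"
  using pair_identity[of "\<lambda>k. real_of_int k - \<mu>" 1] integrable_W2 expectation_centred2
  by (simp add: power2_eq_square)

lemma variance_R: "variance R = expectation (\<lambda>\<omega>. (R \<omega>)\<^sup>2)"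
  by (simp add: expectation_R)

lemma abs_expectation_R_mult_le:
  fixes \<phi> :: "int \<Rightarrow> real"
  assumes "integrable M (\<lambda>\<omega>. (\<phi> (W \<omega>))\<^sup>2)" "expectation (\<lambda>\<omega>. (\<phi> (W \<omega>))\<^sup>2) \<le> c\<^sup>2" "0 \<le> c"
  shows "\<bar>expectation (\<lambda>\<omega>. R \<omega> * \<phi> (W \<omega>))\<bar> \<le> sqrt (variance R) * c"
proof -
  have "\<bar>expectation (\<lambda>\<omega>. R \<omega> * \<phi> (W \<omega>))\<bar>
      \<le> sqrt (expectation (\<lambda>\<omega>. (R \<omega>)\<^sup>2)) * sqrt (expectation (\<lambda>\<omega>. (\<phi> (W \<omega>))\<^sup>2))"
    by (rule abs_integral_mult_le) (use integrable_R2 assms in auto)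
  also have "\<dots> \<le> sqrt (variance R) * c"
    unfolding variance_R using assms by (intro mult_left_mono real_le_lsqrt) auto
  finally show ?thesis .
qed

end

section \<open>Comparison with the translated Poisson law\<close>

context unit_step_pair
begin

text \<open>The translated Poisson law with parameters \<open>\<mu>\<close> and \<open>\<sigma>\<^sup>2\<close> is the Poisson law with mean \<open>\<nu>\<close>
  moved by \<open>m\<close>; it has the mean \<open>m + \<nu> = \<mu>\<close>, and its variance \<open>\<nu>\<close> exceeds \<open>\<sigma>\<^sup>2\<close> by less than 1.\<close>

definition m :: int where "m = \<lfloor>\<mu> - \<sigma>\<^sup>2\<rfloor>"

definition \<nu> :: real where "\<nu> = \<sigma>\<^sup>2 + frac (\<mu> - \<sigma>\<^sup>2)"

lemma nu_bounds: "\<sigma>\<^sup>2 \<le> \<nu>" "\<nu> \<le> \<sigma>\<^sup>2 + 1"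
  using frac_lt_1[of "\<mu> - \<sigma>\<^sup>2"] by (simp_all add: \<nu>_def)

lemma sigma2_pos: "0 < \<sigma>\<^sup>2"
  using sigma_pos by simp

lemma nu_pos: "0 < \<nu>"
  using nu_bounds sigma2_pos by linarith

lemma shift_nu: "real_of_int m + \<nu> = \<mu>"
  by (simp add: m_def \<nu>_def frac_def)

lemma inverse_nu_le: "1 / \<nu> \<le> 1 / \<sigma>\<^sup>2" "2 / \<nu> \<le> 2 / \<sigma>\<^sup>2"
  using nu_bounds sigma2_pos by (auto intro!: divide_left_mono mult_pos_pos nu_pos)

text \<open>The Stein solution for the point \<open>m + n\<close> of the translated Poisson law, and its differences.\<close>

definition G :: "nat \<Rightarrow> int \<Rightarrow> real" where
  "G n k = poisson_stein \<nu> n (nat (k - m))"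

definition D :: "nat \<Rightarrow> int \<Rightarrow> real" where
  "D n k = G n (k + 1) - G n k"

lemma abs_G: "\<bar>G n k\<bar> \<le> 1 / \<sigma>\<^sup>2"
  using abs_poisson_stein[OF nu_pos, of n "nat (k - m)"] inverse_nu_le unfolding G_def by linarith

lemma abs_D: "\<bar>D n k\<bar> \<le> 1 / \<sigma>\<^sup>2"
  using abs_int_poisson_stein_difference[OF nu_pos, of n "k - m"] inverse_nu_le
  unfolding D_def G_def by (simp add: algebra_simps)

lemma sum_abs_D:
  assumes "finite A"
  shows "(\<Sum>k\<in>A. \<bar>D n k\<bar>) \<le> 2 / \<sigma>\<^sup>2"
proof -
  have "(\<Sum>k\<in>A. \<bar>D n k\<bar>)
      = (\<Sum>j\<in>(\<lambda>k. k - m) ` A. \<bar>poisson_stein \<nu> n (nat (j + 1)) - poisson_stein \<nu> n (nat j)\<bar>)"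
    by (subst sum.reindex) (auto simp: inj_on_def D_def G_def algebra_simps)
  also have "\<dots> \<le> 2 / \<nu>"
    using assms by (intro sum_abs_int_poisson_stein_differences nu_pos) auto
  finally show ?thesis using inverse_nu_le by linarith
qed

text \<open>To the left of \<open>m\<close>, where the translated Poisson law has no mass, \<open>G\<close> vanishes.\<close>

lemma G_equation:
  "\<nu> * D n k - (real_of_int k - \<mu>) * G n k
     = of_bool (m \<le> k) * (of_bool (k = m + int n) - pmf (poisson_pmf \<nu>) n)"
proof -
  have centred: "real_of_int k - \<mu> = real_of_int (k - m) - \<nu>"
    using shift_nu by simp
  have "\<nu> * D n k - (real_of_int k - \<mu>) * G n k = \<nu> * G n (k + 1) - real_of_int (k - m) * G n k"
    unfolding D_def centred by (simp add: algebra_simps)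
  also have "\<dots> = of_bool (m \<le> k) * (of_bool (k = m + int n) - pmf (poisson_pmf \<nu>) n)"
  proof (cases "m \<le> k")
    case True
    define i where "i = nat (k - m)"
    have k: "k = m + int i" using True by (simp add: i_def)
    have "nat (k + 1 - m) = Suc i" "nat (k - m) = i" by (simp_all add: k)
    then show ?thesis
      using poisson_stein_equation[OF nu_pos, of n i] by (simp add: G_def k del: pmf_poisson)
  next
    case False
    then show ?thesis by (simp add: G_def)
  qed
  finally show ?thesis .
qed

lemma integrable_D: "integrable M (\<lambda>\<omega>. D n (W \<omega>))"
  by (rule integrable_fun_W[OF abs_D])

lemma integrable_G2: "integrable M (\<lambda>\<omega>. (G n (W \<omega>))\<^sup>2)"
  using integrable_fun_W[of "\<lambda>k. (G n k)\<^sup>2", OF abs_power2_le[OF abs_G]] .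

lemma integrable_D2: "integrable M (\<lambda>\<omega>. (D n (W \<omega>))\<^sup>2)"
  using integrable_fun_W[of "\<lambda>k. (D n k)\<^sup>2", OF abs_power2_le[OF abs_D]] .

text \<open>This is where the smoothness of the law of \<open>W\<close> enters: the differences \<open>D\<close> have an absolute sum
  of at most \<open>2 / \<sigma>\<^sup>2\<close>, so that their expectation is small if no point has much mass.\<close>

lemma expectation_weighted_D_le:
  assumes "integrable M (\<lambda>\<omega>. \<psi> (W \<omega>) * \<bar>D n (W \<omega>)\<bar>)" "0 \<le> c"
    and "\<And>k. \<psi> k * prob {\<omega>\<in>space M. W \<omega> = k} \<le> c"
  shows "expectation (\<lambda>\<omega>. \<psi> (W \<omega>) * \<bar>D n (W \<omega>)\<bar>) \<le> c * (2 / \<sigma>\<^sup>2)"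
proof (rule expectation_le_by_atoms[OF W_measurable, of "\<lambda>k. \<psi> k * \<bar>D n k\<bar>" c "\<lambda>k. \<bar>D n k\<bar>"])
  show "\<psi> k * \<bar>D n k\<bar> * prob {\<omega>\<in>space M. W \<omega> = k} \<le> c * \<bar>D n k\<bar>" for k
    using mult_right_mono[OF assms(3)[of k] abs_ge_zero[of "D n k"]] by (simp add: mult_ac)
qed (use assms sum_abs_D in auto)

lemma expectation_abs_D: "expectation (\<lambda>\<omega>. \<bar>D n (W \<omega>)\<bar>) \<le> q * (2 / \<sigma>\<^sup>2)"
  using expectation_weighted_D_le[of "\<lambda>_. 1" n q] integrable_D q_nonneg prob_atom_le_q by simp

lemma expectation_D2: "expectation (\<lambda>\<omega>. (D n (W \<omega>))\<^sup>2) \<le> 2 * q / (\<sigma>\<^sup>2)\<^sup>2"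
proof -
  have "expectation (\<lambda>\<omega>. \<bar>D n (W \<omega>)\<bar> * \<bar>D n (W \<omega>)\<bar>) \<le> (1 / \<sigma>\<^sup>2 * q) * (2 / \<sigma>\<^sup>2)"
  proof (rule expectation_weighted_D_le)
    show "\<bar>D n k\<bar> * prob {\<omega>\<in>space M. W \<omega> = k} \<le> 1 / \<sigma>\<^sup>2 * q" for k
      by (intro mult_mono abs_D prob_atom_le_q) auto
  qed (use integrable_D2 q_nonneg in \<open>auto simp: power2_eq_square\<close>)
  then show ?thesis by (simp add: power2_eq_square mult_ac)
qed

lemma prob_left_of_support: "prob {\<omega>\<in>space M. W \<omega> < m} \<le> 1 / \<sigma>\<^sup>2"
proof -
  have "prob {\<omega>\<in>space M. W \<omega> < m}
      \<le> prob {\<omega>\<in>space M. \<nu> \<le> \<bar>real_of_int (W \<omega>) - expectation (\<lambda>\<omega>. real_of_int (W \<omega>))\<bar>}"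
  proof (rule finite_measure_mono)
    show "{\<omega>\<in>space M. W \<omega> < m}
        \<subseteq> {\<omega>\<in>space M. \<nu> \<le> \<bar>real_of_int (W \<omega>) - expectation (\<lambda>\<omega>. real_of_int (W \<omega>))\<bar>}"
    proof (safe)
      fix \<omega> assume "W \<omega> < m"
      then have "real_of_int (W \<omega>) < real_of_int m" by simp
      then show "\<nu> \<le> \<bar>real_of_int (W \<omega>) - expectation (\<lambda>\<omega>. real_of_int (W \<omega>))\<bar>"
        unfolding expectation_W using shift_nu by linarith
    qed
  qed (measurable)
  also have "\<dots> \<le> \<sigma>\<^sup>2 / \<nu>\<^sup>2"
  proof -
    have "integrable M (\<lambda>\<omega>. (real_of_int (W \<omega>))\<^sup>2)"
    proof -
      have "integrable M (\<lambda>\<omega>. (real_of_int (W \<omega>) - \<mu>)\<^sup>2 + 2 * \<mu> * real_of_int (W \<omega>) - \<mu>\<^sup>2)"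
        using integrable_W2 integrable_W by simp
      then show ?thesis by (simp add: power2_diff algebra_simps)
    qed
    then show ?thesis
      using Chebyshev_inequality[OF measurable_fun_W[of real_of_int] _ nu_pos] variance_W by simp
  qed
  also have "\<dots> \<le> \<sigma>\<^sup>2 / (\<sigma>\<^sup>2)\<^sup>2"
    using nu_bounds(1) sigma2_pos by (intro divide_left_mono power_mono mult_pos_pos) (auto simp: nu_pos)
  finally show ?thesis using sigma_pos by (simp add: power2_eq_square)
qed

text \<open>The part of the error that stems from the remainder \<open>R\<close>, from \<open>\<nu> \<noteq> \<sigma>\<^sup>2\<close> and from the mass of
  \<open>W\<close> to the left of \<open>m\<close>.\<close>

definition base_error :: real where
  "base_error = 2 * q * sqrt (variance R) / (lam * \<sigma>) + sqrt (variance R) / (lam * \<sigma>\<^sup>2) + 2 / \<sigma>\<^sup>2"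

definition up_cov :: "nat \<Rightarrow> real" where
  "up_cov n = expectation (\<lambda>\<omega>. (S \<omega> - expectation S) * D n (W \<omega>))"

lemma base_error_ge: "1 / \<sigma>\<^sup>2 \<le> base_error"
proof -
  have "0 \<le> variance R" by simp
  then have "0 \<le> 2 * q * sqrt (variance R) / (lam * \<sigma>) + sqrt (variance R) / (lam * \<sigma>\<^sup>2)"
    using q_nonneg lam_pos sigma_pos
    by (intro add_nonneg_nonneg divide_nonneg_nonneg mult_nonneg_nonneg) auto
  moreover have "1 / \<sigma>\<^sup>2 \<le> 2 / \<sigma>\<^sup>2"
    by (intro divide_right_mono) auto
  ultimately show ?thesis unfolding base_error_def by linarith
qed

lemma integrable_up_cov: "integrable M (\<lambda>\<omega>. (S \<omega> - expectation S) * D n (W \<omega>))"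
  by (rule integrable_mult_of_squares)
    (use integrable_S_centred2 integrable_D2 measurable_fun_W in auto)

lemma stein_expectation:
  "\<nu> * expectation (\<lambda>\<omega>. D n (W \<omega>)) - expectation (\<lambda>\<omega>. (real_of_int (W \<omega>) - \<mu>) * G n (W \<omega>))
     = prob {\<omega>\<in>space M. W \<omega> = m + int n}
       - pmf (poisson_pmf \<nu>) n * prob {\<omega>\<in>space M. m \<le> W \<omega>}"
proof -
  let ?w = "\<lambda>\<omega>. real_of_int (W \<omega>) - \<mu>"
  have wG: "integrable M (\<lambda>\<omega>. ?w \<omega> * G n (W \<omega>))"
    by (rule integrable_mult_of_squares)
      (use integrable_W2 integrable_G2 measurable_fun_W in auto)
  let ?A = "{\<omega>\<in>space M. W \<omega> = m + int n}" and ?B = "{\<omega>\<in>space M. m \<le> W \<omega>}"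
  have int: "integrable M (indicator ?A :: 'a \<Rightarrow> real)" "integrable M (indicator ?B :: 'a \<Rightarrow> real)"
    by (auto intro!: integrable_real_indicator simp: emeasure_eq_measure)
  have "\<nu> * expectation (\<lambda>\<omega>. D n (W \<omega>)) - expectation (\<lambda>\<omega>. ?w \<omega> * G n (W \<omega>))
      = expectation (\<lambda>\<omega>. \<nu> * D n (W \<omega>) - ?w \<omega> * G n (W \<omega>))"
    using wG integrable_D by simp
  also have "\<dots> = expectation (\<lambda>\<omega>. indicator ?A \<omega> - pmf (poisson_pmf \<nu>) n * indicator ?B \<omega>)"
    by (intro Bochner_Integration.integral_cong) (auto simp: G_equation indicator_def)
  also have "\<dots> = expectation (indicator ?A) - pmf (poisson_pmf \<nu>) n * expectation (indicator ?B)"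
    using int by (simp del: pmf_poisson Bochner_Integration.integral_indicator)
  also have "\<dots> = prob ?A - pmf (poisson_pmf \<nu>) n * prob ?B"
    by (simp del: pmf_poisson)
  finally show ?thesis .
qed

text \<open>The identity for exchangeable pairs turns the left-hand side of the Stein equation into
  \<open>(\<nu> - \<sigma>\<^sup>2 + \<E>[R (W - \<mu>)] / lam) \<E> D(W) - \<E>[R G(W)] / lam - \<E>[(S - \<E> S) D(W)] / lam\<close>,
  because \<open>lam \<sigma>\<^sup>2 = \<E>[R (W - \<mu>)] + \<E> S\<close>.\<close>

lemma point_error_right:
  "\<bar>prob {\<omega>\<in>space M. W \<omega> = m + int n} - pmf (poisson_pmf \<nu>) n\<bar> \<le> \<bar>up_cov n\<bar> / lam + base_error"
proof -
  let ?w = "\<lambda>\<omega>. real_of_int (W \<omega>) - \<mu>"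
  let ?pi = "pmf (poisson_pmf \<nu>) n"
  let ?sR = "sqrt (variance R)"
  define ED where "ED = expectation (\<lambda>\<omega>. D n (W \<omega>))"
  define EwG where "EwG = expectation (\<lambda>\<omega>. ?w \<omega> * G n (W \<omega>))"
  define ERG where "ERG = expectation (\<lambda>\<omega>. R \<omega> * G n (W \<omega>))"
  define ERw where "ERw = expectation (\<lambda>\<omega>. R \<omega> * ?w \<omega>)"
  define left where "left = prob {\<omega>\<in>space M. W \<omega> < m}"
  have "expectation (\<lambda>\<omega>. S \<omega> * D n (W \<omega>))
      = expectation (\<lambda>\<omega>. (S \<omega> - expectation S) * D n (W \<omega>) + expectation S * D n (W \<omega>))"
    by (simp add: algebra_simps)
  also have "\<dots> = up_cov n + expectation S * ED"
    using integrable_up_cov integrable_D by (simp add: up_cov_def ED_def)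
  finally have ESD: "expectation (\<lambda>\<omega>. S \<omega> * D n (W \<omega>)) = up_cov n + expectation S * ED" .
  have "lam * EwG = ERG + (up_cov n + expectation S * ED)"
    using pair_identity[OF integrable_G2, of n "1 / \<sigma>\<^sup>2"] abs_D[of n] ESD
    by (simp add: EwG_def ERG_def D_def)
  also have "expectation S = lam * \<sigma>\<^sup>2 - ERw"
    using expectation_R_centred by (simp add: ERw_def)
  finally have "lam * EwG = lam * (ERG / lam + up_cov n / lam + \<sigma>\<^sup>2 * ED - ERw * ED / lam)"
    using lam_pos by (simp add: algebra_simps)
  then have wG: "EwG = ERG / lam + up_cov n / lam + \<sigma>\<^sup>2 * ED - ERw * ED / lam"
    using lam_pos by simp
  have right: "prob {\<omega>\<in>space M. m \<le> W \<omega>} = 1 - left"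
  proof -
    have "left = prob (space M - {\<omega>\<in>space M. m \<le> W \<omega>})"
      unfolding left_def by (rule arg_cong[where f = prob]) auto
    also have "\<dots> = 1 - prob {\<omega>\<in>space M. m \<le> W \<omega>}"
      by (rule prob_compl) measurable
    finally show ?thesis by simp
  qed
  have "prob {\<omega>\<in>space M. W \<omega> = m + int n} - ?pi = \<nu> * ED - EwG - ?pi * left"
    using stein_expectation[of n] unfolding ED_def[symmetric] EwG_def[symmetric] right
    by (simp add: right_diff_distrib del: pmf_poisson)
  also have "\<dots> = (\<nu> - \<sigma>\<^sup>2) * ED + ERw * ED / lam - ERG / lam - up_cov n / lam - ?pi * left"
    unfolding wG by (simp add: algebra_simps del: pmf_poisson)
  finally have eq: "prob {\<omega>\<in>space M. W \<omega> = m + int n} - ?pi = \<dots>" .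

  have ED1: "\<bar>ED\<bar> \<le> 1 / \<sigma>\<^sup>2"
  proof -
    have "\<bar>ED\<bar> \<le> expectation (\<lambda>\<omega>. \<bar>D n (W \<omega>)\<bar>)"
      unfolding ED_def by (rule integral_abs_bound)
    also have "\<dots> \<le> expectation (\<lambda>_. 1 / \<sigma>\<^sup>2)"
      using integrable_D by (intro integral_mono abs_D) auto
    finally show ?thesis by (simp add: prob_space)
  qed
  have ED2: "\<bar>ED\<bar> \<le> q * (2 / \<sigma>\<^sup>2)"
    using integral_abs_bound[of M "\<lambda>\<omega>. D n (W \<omega>)"] expectation_abs_D[of n] unfolding ED_def by linarith
  have t1: "\<bar>(\<nu> - \<sigma>\<^sup>2) * ED\<bar> \<le> 1 / \<sigma>\<^sup>2"
    using mult_mono[of "\<bar>\<nu> - \<sigma>\<^sup>2\<bar>" 1 "\<bar>ED\<bar>" "1 / \<sigma>\<^sup>2"] nu_bounds ED1 by (simp add: abs_mult)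
  have t2: "\<bar>ERw * ED / lam\<bar> \<le> 2 * q * ?sR / (lam * \<sigma>)"
  proof -
    have "\<bar>ERw\<bar> \<le> ?sR * \<sigma>"
      unfolding ERw_def
      by (rule abs_expectation_R_mult_le) (use integrable_W2 expectation_centred2 sigma_pos in auto)
    then have "\<bar>ERw * ED\<bar> \<le> (?sR * \<sigma>) * (q * (2 / \<sigma>\<^sup>2))"
      unfolding abs_mult using sigma_pos by (intro mult_mono ED2) auto
    then have "\<bar>ERw * ED\<bar> / lam \<le> (?sR * \<sigma>) * (q * (2 / \<sigma>\<^sup>2)) / lam"
      using lam_pos by (intro divide_right_mono) auto
    also have "\<dots> = 2 * q * ?sR / (lam * \<sigma>)"
      using sigma_pos lam_pos by (simp add: power2_eq_square mult_ac)
    finally show ?thesis using lam_pos by simp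
  qed
  have t3: "\<bar>ERG / lam\<bar> \<le> ?sR / (lam * \<sigma>\<^sup>2)"
  proof -
    have "expectation (\<lambda>\<omega>. (G n (W \<omega>))\<^sup>2) \<le> expectation (\<lambda>_. (1 / \<sigma>\<^sup>2)\<^sup>2)"
      using integrable_G2 square_le_of_abs_le[OF abs_G] by (intro integral_mono) auto
    then have "\<bar>ERG\<bar> \<le> ?sR * (1 / \<sigma>\<^sup>2)"
      unfolding ERG_def by (intro abs_expectation_R_mult_le integrable_G2) (auto simp: prob_space)
    then have "\<bar>ERG\<bar> / lam \<le> ?sR * (1 / \<sigma>\<^sup>2) / lam"
      using lam_pos by (intro divide_right_mono) auto
    then show ?thesis using lam_pos by (simp add: mult.commute)
  qed
  have t4: "\<bar>?pi * left\<bar> \<le> 1 / \<sigma>\<^sup>2"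
  proof -
    have "?pi * left \<le> 1 * left"
      by (intro mult_right_mono pmf_le_1) (simp add: left_def)
    moreover have "0 \<le> ?pi * left" by (intro mult_nonneg_nonneg pmf_nonneg) (simp add: left_def)
    ultimately show ?thesis
      using prob_left_of_support unfolding left_def by linarith
  qed
  have t5: "\<bar>up_cov n / lam\<bar> = \<bar>up_cov n\<bar> / lam"
    using lam_pos by simp
  have t6: "2 / \<sigma>\<^sup>2 = 1 / \<sigma>\<^sup>2 + 1 / \<sigma>\<^sup>2" by simp
  show ?thesis
    unfolding eq base_error_def using t1 t2 t3 t4 t5 t6 by linarith
qed

lemma pmf_translated_poisson_right:
  "pmf (translated_poisson \<mu> (\<sigma>\<^sup>2)) (m + int n) = pmf (poisson_pmf \<nu>) n"
proof -
  have "pmf (map_pmf (\<lambda>n. int n + m) (poisson_pmf \<nu>)) (int n + m) = pmf (poisson_pmf \<nu>) n"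
    by (rule pmf_map_inj') (simp add: inj_def)
  then show ?thesis
    by (simp add: translated_poisson_def m_def \<nu>_def add.commute del: pmf_poisson)
qed

lemma pmf_translated_poisson_left:
  assumes "k < m"
  shows "pmf (translated_poisson \<mu> (\<sigma>\<^sup>2)) k = 0"
  unfolding translated_poisson_def
  by (rule pmf_map_outside) (use assms in \<open>auto simp: m_def\<close>)

lemma translated_poisson_deviation:
  "\<bar>real_of_int k - \<mu>\<bar> * pmf (translated_poisson \<mu> (\<sigma>\<^sup>2)) k \<le> 1"
proof (cases "k < m")
  case False
  then obtain n where k: "k = m + int n"
    using zle_iff_zadd[of m k] by auto
  have centred: "real_of_int k - \<mu> = real n - \<nu>"
    using shift_nu by (simp add: k)
  have weight: "pmf (translated_poisson \<mu> (\<sigma>\<^sup>2)) k = pmf (poisson_pmf \<nu>) n"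
    unfolding k by (rule pmf_translated_poisson_right)
  show ?thesis
    unfolding centred weight by (rule poisson_deviation_weight_le_1[OF nu_pos])
qed (simp add: pmf_translated_poisson_left)

lemma point_error:
  assumes "\<And>n. \<bar>up_cov n\<bar> \<le> c"
  shows "\<bar>prob {\<omega>\<in>space M. W \<omega> = k} - pmf (translated_poisson \<mu> (\<sigma>\<^sup>2)) k\<bar> \<le> c / lam + base_error"
proof (cases "k < m")
  case True
  have "prob {\<omega>\<in>space M. W \<omega> = k} \<le> prob {\<omega>\<in>space M. W \<omega> < m}"
    using True by (intro finite_measure_mono) auto
  moreover have "0 \<le> c / lam"
    using assms[of 0] lam_pos by (intro divide_nonneg_nonneg) auto
  ultimately show ?thesis
    using prob_left_of_support base_error_ge by (simp add: pmf_translated_poisson_left[OF True])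
next
  case False
  then obtain n where k: "k = m + int n"
    using zle_iff_zadd[of m k] by auto
  have "\<bar>up_cov n\<bar> / lam \<le> c / lam"
    using assms[of n] lam_pos by (intro divide_right_mono) auto
  then show ?thesis
    using point_error_right[of n] unfolding k pmf_translated_poisson_right by linarith
qed

lemma up_cov_le_variance: "\<bar>up_cov n\<bar> \<le> 2 * sqrt (q * variance S) / \<sigma>\<^sup>2"
proof -
  have "\<bar>up_cov n\<bar> \<le> sqrt (variance S) * sqrt (expectation (\<lambda>\<omega>. (D n (W \<omega>))\<^sup>2))"
    unfolding up_cov_def
    by (rule abs_integral_mult_le) (use integrable_S_centred2 integrable_D2 measurable_fun_W in auto)
  also have "\<dots> \<le> sqrt (variance S) * sqrt (4 * q / (\<sigma>\<^sup>2)\<^sup>2)"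
  proof (intro mult_left_mono real_sqrt_le_mono)
    have "2 * q / (\<sigma>\<^sup>2)\<^sup>2 \<le> 4 * q / (\<sigma>\<^sup>2)\<^sup>2"
      using q_nonneg by (intro divide_right_mono) auto
    then show "expectation (\<lambda>\<omega>. (D n (W \<omega>))\<^sup>2) \<le> 4 * q / (\<sigma>\<^sup>2)\<^sup>2"
      using expectation_D2[of n] by linarith
  qed simp
  also have "\<dots> = 2 * sqrt (q * variance S) / \<sigma>\<^sup>2"
    unfolding real_sqrt_divide real_sqrt_mult real_sqrt_abs by simp
  finally show ?thesis .
qed

lemma expectation_abs_centred: "expectation (\<lambda>\<omega>. \<bar>real_of_int (W \<omega>) - \<mu>\<bar>) \<le> \<sigma>"
proof -
  have "\<bar>expectation (\<lambda>\<omega>. \<bar>real_of_int (W \<omega>) - \<mu>\<bar> * 1)\<bar>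
      \<le> sqrt (expectation (\<lambda>\<omega>. \<bar>real_of_int (W \<omega>) - \<mu>\<bar>\<^sup>2)) * sqrt (expectation (\<lambda>_. 1\<^sup>2))"
    by (rule abs_integral_mult_le) (use integrable_W2 in auto)
  then show ?thesis
    using expectation_centred2 sigma_pos by (simp add: prob_space)
qed

text \<open>The deviation of \<open>s(W)\<close> from its mean is at most \<open>L \<bar>W - \<mu>\<bar> + L \<E> \<bar>W - \<mu>\<bar>\<close>.  The factor
  \<open>\<bar>W - \<mu>\<bar>\<close> is not small, but at each point it only appears multiplied by the mass at that point.\<close>

lemma up_cov_le_lipschitz:
  assumes lip: "L-lipschitz_on UNIV s" and S: "AE \<omega> in M. S \<omega> = s (real_of_int (W \<omega>))"
    and c: "\<And>k. \<bar>real_of_int k - \<mu>\<bar> * prob {\<omega>\<in>space M. W \<omega> = k} \<le> c"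
  shows "\<bar>up_cov n\<bar> \<le> 2 * L * c / \<sigma>\<^sup>2 + 2 * L * q / \<sigma>"
proof -
  let ?w = "\<lambda>\<omega>. real_of_int (W \<omega>) - \<mu>"
  have L: "0 \<le> L" using lip by (rule lipschitz_on_nonneg)
  have c0: "0 \<le> c" using c[of 0] by (smt (verit) measure_nonneg mult_nonneg_nonneg)
  have lipD: "\<bar>s x - s y\<bar> \<le> L * \<bar>x - y\<bar>" for x y
    using lipschitz_onD[OF lip, of x y] by (simp add: dist_real_def)
  have Sw: "AE \<omega> in M. \<bar>S \<omega> - s \<mu>\<bar> \<le> L * \<bar>?w \<omega>\<bar>"
    using S by eventually_elim (simp add: lipD)
  have ES: "\<bar>expectation S - s \<mu>\<bar> \<le> L * \<sigma>"
  proof -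
    have "expectation S - s \<mu> = expectation (\<lambda>\<omega>. S \<omega> - s \<mu>)"
      using integrable_S by (simp add: prob_space)
    also have "\<bar>\<dots>\<bar> \<le> expectation (\<lambda>\<omega>. \<bar>S \<omega> - s \<mu>\<bar>)"
      by (rule integral_abs_bound)
    also have "\<dots> \<le> expectation (\<lambda>\<omega>. L * \<bar>?w \<omega>\<bar>)"
      using Sw integrable_S integrable_centred by (intro integral_mono_AE) auto
    also have "\<dots> \<le> L * \<sigma>"
      using expectation_abs_centred L by (simp add: mult_left_mono)
    finally show ?thesis .
  qed
  have wD: "integrable M (\<lambda>\<omega>. \<bar>?w \<omega>\<bar> * \<bar>D n (W \<omega>)\<bar>)"
    by (rule integrable_mult_of_squares)
      (use integrable_W2 integrable_D2 measurable_fun_W[of "D n"] in auto)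
  have aD: "integrable M (\<lambda>\<omega>. \<bar>D n (W \<omega>)\<bar>)"
    using integrable_D by simp
  have "\<bar>up_cov n\<bar> \<le> expectation (\<lambda>\<omega>. \<bar>(S \<omega> - expectation S) * D n (W \<omega>)\<bar>)"
    unfolding up_cov_def by (rule integral_abs_bound)
  also have "\<dots> \<le> expectation (\<lambda>\<omega>. L * (\<bar>?w \<omega>\<bar> * \<bar>D n (W \<omega>)\<bar>) + L * \<sigma> * \<bar>D n (W \<omega>)\<bar>)"
  proof (rule integral_mono_AE)
    show "AE \<omega> in M. \<bar>(S \<omega> - expectation S) * D n (W \<omega>)\<bar>
        \<le> L * (\<bar>?w \<omega>\<bar> * \<bar>D n (W \<omega>)\<bar>) + L * \<sigma> * \<bar>D n (W \<omega>)\<bar>"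
      using Sw
    proof eventually_elim
      case (elim \<omega>)
      have "\<bar>S \<omega> - expectation S\<bar> \<le> L * \<bar>?w \<omega>\<bar> + L * \<sigma>"
        using elim ES by linarith
      from mult_right_mono[OF this abs_ge_zero[of "D n (W \<omega>)"]] show ?case
        unfolding abs_mult by (simp add: algebra_simps)
    qed
  qed (use integrable_up_cov wD aD in auto)
  also have "\<dots> = L * expectation (\<lambda>\<omega>. \<bar>?w \<omega>\<bar> * \<bar>D n (W \<omega>)\<bar>) + L * \<sigma> * expectation (\<lambda>\<omega>. \<bar>D n (W \<omega>)\<bar>)"
    using wD aD by simp
  also have "\<dots> \<le> L * (c * (2 / \<sigma>\<^sup>2)) + L * \<sigma> * (q * (2 / \<sigma>\<^sup>2))"
    using L sigma_pos c c0 wD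
    by (intro add_mono mult_left_mono expectation_abs_D
        expectation_weighted_D_le[of "\<lambda>k. \<bar>real_of_int k - \<mu>\<bar>"]) auto
  also have "\<dots> = 2 * L * c / \<sigma>\<^sup>2 + 2 * L * q / \<sigma>"
    using sigma_pos by (simp add: power2_eq_square mult_ac)
  finally show ?thesis .
qed

lemma moment_atom:
  assumes "integrable M (\<lambda>\<omega>. \<bar>real_of_int (W \<omega>) - \<mu>\<bar> ^ r)"
  shows "\<bar>real_of_int k - \<mu>\<bar> ^ r * prob {\<omega>\<in>space M. W \<omega> = k}
    \<le> expectation (\<lambda>\<omega>. \<bar>real_of_int (W \<omega>) - \<mu>\<bar> ^ r)"
proof -
  let ?A = "{\<omega>\<in>space M. W \<omega> = k}"
  have A: "?A \<in> sets M" by measurable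
  have "\<bar>real_of_int k - \<mu>\<bar> ^ r * prob ?A = expectation (\<lambda>\<omega>. \<bar>real_of_int k - \<mu>\<bar> ^ r * indicator ?A \<omega>)"
    using A by simp
  also have "\<dots> \<le> expectation (\<lambda>\<omega>. \<bar>real_of_int (W \<omega>) - \<mu>\<bar> ^ r)"
  proof (rule integral_mono)
    have "integrable M (indicator ?A :: 'a \<Rightarrow> real)"
      using A by (rule integrable_real_indicator) (simp add: emeasure_eq_measure)
    then show "integrable M (\<lambda>\<omega>. \<bar>real_of_int k - \<mu>\<bar> ^ r * indicator ?A \<omega>)"
      by (rule integrable_mult_right)
  qed (use assms in \<open>auto simp: indicator_def\<close>)
  finally show ?thesis .
qed

text \<open>Far from the mean, the third moment controls the point probabilities.  Close to it, they are
  compared with those of the translated Poisson law through the local bound by \<open>d\<close>, in which the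
  Cauchy-Schwarz inequality has been applied to \<open>up_cov\<close>; for the translated Poisson law itself, the
  product of distance and weight is at most 1.\<close>

lemma atom_deviation:
  assumes int3: "integrable M (\<lambda>\<omega>. \<bar>real_of_int (W \<omega>) - \<mu>\<bar> ^ 3)"
    and d: "2 * sqrt (q * variance S) / (lam * \<sigma>\<^sup>2) + base_error \<le> d"
  shows "\<bar>real_of_int k - \<mu>\<bar> * prob {\<omega>\<in>space M. W \<omega> = k}
    \<le> max (1 / \<sigma> ^ 3 * expectation (\<lambda>\<omega>. \<bar>real_of_int (W \<omega>) - \<mu>\<bar> ^ 3)) (d * \<sigma> powr (3 / 2) + 1)"
proof -
  define x where "x = \<bar>real_of_int k - \<mu>\<bar>"
  define p where "p = prob {\<omega>\<in>space M. W \<omega> = k}"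
  define I where "I = expectation (\<lambda>\<omega>. \<bar>real_of_int (W \<omega>) - \<mu>\<bar> ^ 3)"
  have x0: "0 \<le> x" and p0: "0 \<le> p" by (simp_all add: x_def p_def)
  have powr2: "(\<sigma> powr (3 / 2))\<^sup>2 = \<sigma> ^ 3"
  proof -
    have "(\<sigma> powr (3 / 2))\<^sup>2 = \<sigma> powr (3 / 2 + 3 / 2)"
      unfolding powr_add by (rule power2_eq_square)
    also have "\<dots> = \<sigma> powr real 3" by simp
    also have "\<dots> = \<sigma> ^ 3" using sigma_pos by (rule powr_realpow)
    finally show ?thesis .
  qed
  show ?thesis
  proof (cases "\<sigma> powr (3 / 2) \<le> x")
    case True
    have "\<sigma> ^ 3 \<le> x\<^sup>2"
      unfolding powr2[symmetric] using True by (intro power_mono) auto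
    then have "\<sigma> ^ 3 * (x * p) \<le> x\<^sup>2 * (x * p)"
      using x0 p0 by (intro mult_right_mono) auto
    also have "\<dots> = x ^ 3 * p" by (simp add: power2_eq_square power3_eq_cube)
    also have "\<dots> \<le> I"
      unfolding x_def p_def I_def by (rule moment_atom[OF int3])
    finally have "x * p \<le> 1 / \<sigma> ^ 3 * I"
      using sigma_pos by (simp add: field_simps)
    then show ?thesis unfolding x_def p_def I_def by simp
  next
    case False
    define t where "t = pmf (translated_poisson \<mu> (\<sigma>\<^sup>2)) k"
    have "\<bar>p - t\<bar> \<le> 2 * sqrt (q * variance S) / \<sigma>\<^sup>2 / lam + base_error"
      unfolding p_def t_def by (rule point_error[OF up_cov_le_variance])
    also have "\<dots> \<le> d"
      using d by (simp add: mult.commute)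
    finally have pt: "p \<le> d + t" "0 \<le> d" by auto
    have "x * p \<le> x * (d + t)"
      using pt x0 by (intro mult_left_mono) auto
    also have "\<dots> = d * x + x * t" by (simp add: algebra_simps)
    also have "\<dots> \<le> d * \<sigma> powr (3 / 2) + 1"
      using False pt translated_poisson_deviation[of k]
      by (intro add_mono mult_left_mono) (auto simp: x_def t_def)
    finally show ?thesis unfolding x_def p_def by simp
  qed
qed

lemma d_loc_le:
  assumes "L-lipschitz_on UNIV s" and "AE \<omega> in M. S \<omega> = s (real_of_int (W \<omega>))"
    and "\<And>k. \<bar>real_of_int k - \<mu>\<bar> * prob {\<omega>\<in>space M. W \<omega> = k} \<le> c"
  shows "d_loc (distr M (count_space UNIV) W) (translated_poisson \<mu> (\<sigma>\<^sup>2))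
    \<le> 2 * L / (lam * \<sigma>\<^sup>2) * c + (2 * L * q / (lam * \<sigma>) + base_error)"
  unfolding d_loc_def
proof (rule cSUP_least)
  fix k :: int
  have "measure (distr M (count_space UNIV) W) {k} = prob {\<omega>\<in>space M. W \<omega> = k}"
    by (subst measure_distr) (auto intro!: arg_cong[where f = prob])
  then have "\<bar>measure (distr M (count_space UNIV) W) {k} - measure (translated_poisson \<mu> (\<sigma>\<^sup>2)) {k}\<bar>
      \<le> (2 * L * c / \<sigma>\<^sup>2 + 2 * L * q / \<sigma>) / lam + base_error"
    using point_error[OF up_cov_le_lipschitz[OF assms], of k] by (simp add: pmf.rep_eq)
  also have "\<dots> = 2 * L / (lam * \<sigma>\<^sup>2) * c + (2 * L * q / (lam * \<sigma>) + base_error)"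
    by (simp add: add_divide_distrib mult_ac)
  finally show "\<bar>measure (distr M (count_space UNIV) W) {k} - measure (translated_poisson \<mu> (\<sigma>\<^sup>2)) {k}\<bar>
      \<le> \<dots>" .
qed simp

end

section \<open>The local bound\<close>

theorem theorem3p11:
  fixes M :: "'a measure" and W W' :: "'a \<Rightarrow> int" and R S :: "'a \<Rightarrow> real"
    and \<mu> \<sigma> lam q_max L_S d :: real
  assumes "prob_space M"
    and "W \<in> M \<rightarrow>\<^sub>M count_space UNIV" and "W' \<in> M \<rightarrow>\<^sub>M count_space UNIV"
    and "exchangeable_pair M W W'"
    and "integrable M (\<lambda>\<omega>. real_of_int (W \<omega>))"
    and "prob_space.expectation M (\<lambda>\<omega>. real_of_int (W \<omega>)) = \<mu>"
    and "integrable M (\<lambda>\<omega>. (real_of_int (W \<omega>) - \<mu>)\<^sup>2)"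
    and "prob_space.variance M (\<lambda>\<omega>. real_of_int (W \<omega>)) = \<sigma>\<^sup>2" and "0 < \<sigma>"
    and "0 < lam" and "lam < 1"
    and "R \<in> borel_measurable M"
    and "AE \<omega> in M. cond_exp_given M W (\<lambda>\<omega>. real_of_int (W' \<omega>) - \<mu>) \<omega> =
           (1 - lam) * (real_of_int (W \<omega>) - \<mu>) + R \<omega>"
    and "AE \<omega> in M. W' \<omega> - W \<omega> \<in> {-1, 0, 1}"
    and "S = cond_prob_given M W (\<lambda>\<omega>. W' \<omega> = W \<omega> + 1)"
    and "q_max = (SUP k::int. measure M {\<omega> \<in> space M. W \<omega> = k})"
    and "\<exists>s :: real \<Rightarrow> real. L_S-lipschitz_on UNIV s \<and>
           (AE \<omega> in M. S \<omega> = s (real_of_int (W \<omega>)))"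
    and "d = 2 * sqrt (q_max * prob_space.variance M S) / (lam * \<sigma>\<^sup>2)
           + 2 * q_max * sqrt (prob_space.variance M R) / (lam * \<sigma>)
           + sqrt (prob_space.variance M R) / (lam * \<sigma>\<^sup>2)
           + 2 / \<sigma>\<^sup>2"
  shows "ennreal (d_loc (distr M (count_space UNIV) W) (translated_poisson \<mu> (\<sigma>\<^sup>2)))
    \<le> ennreal (2 * L_S / (lam * \<sigma>\<^sup>2))
        * max (ennreal (1 / \<sigma> ^ 3) * (\<integral>\<^sup>+ \<omega>. ennreal (\<bar>real_of_int (W \<omega>) - \<mu>\<bar> ^ 3) \<partial>M))
              (ennreal (d * \<sigma> powr (3 / 2) + 1))
      + ennreal (2 * L_S * q_max / (lam * \<sigma>)
           + 2 * q_max * sqrt (prob_space.variance M R) / (lam * \<sigma>)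
           + sqrt (prob_space.variance M R) / (lam * \<sigma>\<^sup>2)
           + 2 / \<sigma>\<^sup>2)"
proof -
  interpret prob_space M by fact
  interpret unit_step_pair M W W' R S \<mu> \<sigma> lam
    by unfold_locales (fact assms)+
  have q: "q_max = q"
    unfolding q_def by (fact assms(16))
  obtain s where lip: "L_S-lipschitz_on UNIV s" and s: "AE \<omega> in M. S \<omega> = s (real_of_int (W \<omega>))"
    using assms(17) by blast
  have L: "0 \<le> L_S" using lip by (rule lipschitz_on_nonneg)
  have d: "d = 2 * sqrt (q * variance S) / (lam * \<sigma>\<^sup>2) + base_error"
    unfolding assms(18) q base_error_def by simp
  define rest where "rest = 2 * L_S * q / (lam * \<sigma>) + base_error"
  have rest: "2 * L_S * q_max / (lam * \<sigma>) + 2 * q_max * sqrt (variance R) / (lam * \<sigma>)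
      + sqrt (variance R) / (lam * \<sigma>\<^sup>2) + 2 / \<sigma>\<^sup>2 = rest"
    unfolding rest_def q base_error_def by simp
  have rest0: "0 \<le> rest"
  proof -
    have "0 \<le> 2 * L_S * q / (lam * \<sigma>)"
      using L q_nonneg lam_pos sigma_pos by simp
    moreover have "0 \<le> 1 / \<sigma>\<^sup>2" by simp
    ultimately show ?thesis using base_error_ge unfolding rest_def by linarith
  qed
  let ?dist = "d_loc (distr M (count_space UNIV) W) (translated_poisson \<mu> (\<sigma>\<^sup>2))"
  define C where "C = 2 * L_S / (lam * \<sigma>\<^sup>2)"
  let ?I = "\<integral>\<^sup>+ \<omega>. ennreal (\<bar>real_of_int (W \<omega>) - \<mu>\<bar> ^ 3) \<partial>M"
  let ?max = "max (ennreal (1 / \<sigma> ^ 3) * ?I) (ennreal (d * \<sigma> powr (3 / 2) + 1))"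
  have C0: "0 \<le> C" using L lam_pos by (simp add: C_def)
  have "ennreal ?dist \<le> ennreal C * ?max + ennreal rest"
  proof (cases "L_S = 0")
    case True
    \<comment> \<open>The product of \<open>L_S\<close> and a possibly infinite third moment is 0, so only a finite bound for
      \<open>\<bar>k - \<mu>\<bar> P[W = k]\<close> has to be found; the first moment gives one.\<close>
    have "\<bar>real_of_int k - \<mu>\<bar> * prob {\<omega>\<in>space M. W \<omega> = k} \<le> \<sigma>" for k
      using moment_atom[of 1 k] integrable_centred expectation_abs_centred by simp
    from d_loc_le[OF lip s this] have "?dist \<le> rest"
      using True by (simp add: rest_def)
    then have "ennreal ?dist \<le> ennreal rest" by (rule ennreal_leI)
    then show ?thesis by (rule order_trans) simp
  next
    case False
    then have Cpos: "0 < C" using L lam_pos sigma_pos by (simp add: C_def)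
    show ?thesis
    proof (cases "?I = \<infinity>")
      case True
      have "?max = \<infinity>"
        unfolding True using sigma_pos by (simp add: ennreal_mult_top max_def top_unique)
      then have "ennreal C * ?max = \<infinity>"
        using Cpos by (simp add: ennreal_mult_eq_top_iff)
      then show ?thesis by simp
    next
      case False
      have meas: "(\<lambda>\<omega>. \<bar>real_of_int (W \<omega>) - \<mu>\<bar> ^ 3) \<in> borel_measurable M"
        by measurable
      have int3: "integrable M (\<lambda>\<omega>. \<bar>real_of_int (W \<omega>) - \<mu>\<bar> ^ 3)"
        using False by (intro integrableI_nonneg meas) (auto simp: less_top)
      define I where "I = expectation (\<lambda>\<omega>. \<bar>real_of_int (W \<omega>) - \<mu>\<bar> ^ 3)"
      have I: "?I = ennreal I" "0 \<le> I"
        unfolding I_def using nn_integral_eq_integral[OF int3] by auto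
      define K where "K = max (1 / \<sigma> ^ 3 * I) (d * \<sigma> powr (3 / 2) + 1)"
      have K0: "0 \<le> K"
        unfolding K_def using I sigma_pos by (simp add: le_max_iff_disj)
      have "?max = max (ennreal (1 / \<sigma> ^ 3 * I)) (ennreal (d * \<sigma> powr (3 / 2) + 1))"
        unfolding I(1) using I(2) sigma_pos by (subst ennreal_mult) auto
      also have "\<dots> = ennreal K"
        unfolding K_def by (rule max_of_mono) (simp add: mono_def ennreal_leI)
      finally have max_eq: "?max = ennreal K" .
      have "\<bar>real_of_int k - \<mu>\<bar> * prob {\<omega>\<in>space M. W \<omega> = k} \<le> K" for k
        unfolding K_def I_def by (rule atom_deviation[OF int3]) (simp add: d)
      from d_loc_le[OF lip s this] have "?dist \<le> C * K + rest"
        by (simp add: rest_def C_def)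
      then have "ennreal ?dist \<le> ennreal (C * K + rest)" by (rule ennreal_leI)
      also have "\<dots> = ennreal C * ennreal K + ennreal rest"
        using C0 K0 rest0 by (simp add: ennreal_mult)
      finally show ?thesis unfolding max_eq .
    qed
  qed
  then show ?thesis unfolding rest C_def .
qed

end
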